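(* Let $E\subset\mathbb{T}=\mathbb{R}/\mathbb{Z}$ be a Borel set and let $\mathcal{F}_E\subset\mathbb{C}^{\mathbb{Z}}$ consist of the Fourier transforms $\{\widehat{\mu}(n)\}_{n\in\mathbb{Z}}$ of all finite, complex Borel measures $\mu$ on $\mathbb{T}$ carried by $E$. Then: (i) If $E$ has Lebesgue measure zero then $\mathcal{F}_E$ admits recovery. (ii) If $E$ has positive Lebesgue measure then $\mathcal{F}_E\setminus\{0\}$ does not admit detection.
   Context: A complex measure $\mu$ is carried by $E$ if $|\mu|(\mathbb{T}\setminus E)=0$. Fourier transform: $\widehat{\mu}(n)=\int_{\mathbb{T}} e^{-2\pi i n t}\,d\mu(t)$, $n\in\mathbb{Z}$. Noise: $\xi=(\xi_n)_{n\in\mathbb{Z}}$ is a sequence of independent standard complex Gaussian random variables, meaning that the real and imaginary parts of each $\xi_n$ are independent and each distributed as $N(0,1)$. A set $\mathcal{X}\subset\mathbb{C}^{\mathbb{Z}}$ admits recovery if there is a Borel measurable map $T:\mathbb{C}^{\mathbb{Z}}\to\mathbb{C}^{\mathbb{Z}}$ such that for each $x\in\mathcal{X}$, $T(x+\xi)=x$ almost surely. A set $\mathcal{X}\subset\mathbb{C}^{\mathbb{Z}}$ admits detection if there is a Borel measurable map $T:\mathbb{C}^{\mathbb{Z}}\to\{0,1\}$ such that $T(\xi)=0$ almost surely and, for every $x\in\mathcal{X}$, $T(x+\xi)=1$ almost surely. (Borel structure is that of the product topology.) *)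

theory Defs
  imports "HOL-Probability.Probability"
begin

section \<open>The circle\<close>

quotient_type circle = real / "\<lambda>s t. s - t \<in> \<int>"
  morphisms rep_circle to_circle
proof (rule equivpI)
  show "reflp (\<lambda>s t::real. s - t \<in> \<int>)"
    by (simp add: reflp_def)
  show "symp (\<lambda>s t::real. s - t \<in> \<int>)"
  proof (rule sympI)
    fix s t :: real
    assume "s - t \<in> \<int>"
    then have "- (s - t) \<in> \<int>"
      by (rule Ints_minus)
    then show "t - s \<in> \<int>"
      by simp
  qed
  show "transp (\<lambda>s t::real. s - t \<in> \<int>)"
  proof (rule transpI)
    fix r s t :: real
    assume "r - s \<in> \<int>" "s - t \<in> \<int>"
    then have "(r - s) + (s - t) \<in> \<int>"
      by (rule Ints_add)
    then show "r - t \<in> \<int>"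
      by simp
  qed
qed

text \<open>The quotient topology; it provides the Borel sigma-algebra \<open>borel :: circle measure\<close>.\<close>

instantiation circle :: topological_space
begin

definition open_circle :: "circle set \<Rightarrow> bool"
  where "open_circle U \<longleftrightarrow> open (to_circle -` U)"

instance
  by standard (auto simp: open_circle_def vimage_Union)

end

lemma continuous_on_to_circle: "continuous_on UNIV to_circle"
  by (simp add: continuous_on_open_vimage open_circle_def)

lemma measurable_to_circle [measurable]: "to_circle \<in> borel \<rightarrow>\<^sub>M borel"
  by (intro borel_measurable_continuous_onI continuous_on_to_circle)

definition circle_lebesgue :: "circle measure"
  where "circle_lebesgue = distr (restrict_space lborel {0..<1}) borel to_circle"

lemma emeasure_circle_lebesgue:
  assumes "E \<in> sets borel"
  shows "emeasure circle_lebesgue E = emeasure lborel {t \<in> {0..<1}. to_circle t \<in> E}"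
proof -
  have "to_circle \<in> restrict_space lborel {0..<1} \<rightarrow>\<^sub>M borel"
    by (intro measurable_restrict_space1) simp
  then have "emeasure circle_lebesgue E
      = emeasure (restrict_space lborel {0..<1}) (to_circle -` E \<inter> {0..<1})"
    unfolding circle_lebesgue_def
    by (subst emeasure_distr) (use assms in \<open>auto simp: space_restrict_space\<close>)
  also have "\<dots> = emeasure lborel (to_circle -` E \<inter> {0..<1})"
    by (rule emeasure_restrict_space) auto
  also have "to_circle -` E \<inter> {0..<1} = {t \<in> {0..<1}. to_circle t \<in> E}"
    by auto
  finally show ?thesis .
qed

lift_definition circle_char :: "int \<Rightarrow> circle \<Rightarrow> complex"
  is "\<lambda>n t. exp (2 * of_real pi * \<i> * of_int n * of_real t)"
proof -
  fix n :: int and s t :: real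
  assume "s - t \<in> \<int>"
  then obtain k where "s - t = of_int k"
    by (rule Ints_cases)
  then have "s = t + of_int k"
    by simp
  then have "2 * of_real pi * \<i> * of_int n * complex_of_real s
      = 2 * of_real pi * \<i> * of_int n * of_real t + of_int (2 * (n * k)) * (of_real pi * \<i>)"
    by (simp add: algebra_simps)
  then show "exp (2 * of_real pi * \<i> * of_int n * complex_of_real s)
      = exp (2 * of_real pi * \<i> * of_int n * of_real t)"
    by (auto simp: exp_eq intro!: exI[of _ "n * k"])
qed

section \<open>Complex measures\<close>

text \<open>Only the values on \<open>sets M\<close> are meaningful.\<close>

definition complex_measure :: "'a measure \<Rightarrow> ('a set \<Rightarrow> complex) \<Rightarrow> bool"
  where "complex_measure M \<mu> \<longleftrightarrow> \<mu> {} = 0 \<and>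
    (\<forall>A :: nat \<Rightarrow> 'a set. range A \<subseteq> sets M \<longrightarrow> disjoint_family A \<longrightarrow>
      (\<lambda>n. \<mu> (A n)) sums \<mu> (\<Union>n. A n))"

definition total_variation :: "'a measure \<Rightarrow> ('a set \<Rightarrow> complex) \<Rightarrow> 'a set \<Rightarrow> ennreal"
  where "total_variation M \<mu> A =
    (SUP B \<in> {B :: nat \<Rightarrow> 'a set. range B \<subseteq> sets M \<and> disjoint_family B \<and> (\<Union>n. B n) = A}.
      \<Sum>n. ennreal (cmod (\<mu> (B n))))"

definition carried_by :: "'a measure \<Rightarrow> ('a set \<Rightarrow> complex) \<Rightarrow> 'a set \<Rightarrow> bool"
  where "carried_by M \<mu> E \<longleftrightarrow> total_variation M \<mu> (space M - E) = 0"

text \<open>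
  The upper variation \<open>\<nu>\<^sup>+ A = sup {\<nu> B | B \<subseteq> A}\<close> of a finite signed measure \<open>\<nu>\<close>. Since \<open>ennreal\<close>
  sends negative reals to \<open>0 = \<nu> {}\<close>, the supremum is not affected by the coercion. The Jordan
  decomposition of \<open>\<nu>\<close> is \<open>\<nu>\<^sup>+ - (-\<nu>)\<^sup>+\<close>.
\<close>

definition upper_variation :: "'a measure \<Rightarrow> ('a set \<Rightarrow> real) \<Rightarrow> 'a measure"
  where "upper_variation M \<nu> =
    measure_of (space M) (sets M) (\<lambda>A. SUP B \<in> {B \<in> sets M. B \<subseteq> A}. ennreal (\<nu> B))"

definition signed_integral :: "'a measure \<Rightarrow> ('a set \<Rightarrow> real) \<Rightarrow> ('a \<Rightarrow> complex) \<Rightarrow> complex"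
  where "signed_integral M \<nu> f =
    integral\<^sup>L (upper_variation M \<nu>) f - integral\<^sup>L (upper_variation M (\<lambda>A. - \<nu> A)) f"

definition complex_integral :: "'a measure \<Rightarrow> ('a set \<Rightarrow> complex) \<Rightarrow> ('a \<Rightarrow> complex) \<Rightarrow> complex"
  where "complex_integral M \<mu> f =
    signed_integral M (\<lambda>A. Re (\<mu> A)) f + \<i> * signed_integral M (\<lambda>A. Im (\<mu> A)) f"

definition fourier :: "(circle set \<Rightarrow> complex) \<Rightarrow> int \<Rightarrow> complex"
  where "fourier \<mu> n = complex_integral borel \<mu> (circle_char (- n))"

definition fourier_transforms :: "circle set \<Rightarrow> (int \<Rightarrow> complex) set"
  where "fourier_transforms E =
    {fourier \<mu> | \<mu>. complex_measure borel \<mu> \<and> carried_by borel \<mu> E}"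

section \<open>Noise, recovery and detection\<close>

definition std_complex_gaussian :: "'w measure \<Rightarrow> ('w \<Rightarrow> complex) \<Rightarrow> bool"
  where "std_complex_gaussian P Z \<longleftrightarrow>
    distributed P lborel (\<lambda>\<omega>. Re (Z \<omega>)) std_normal_density \<and>
    distributed P lborel (\<lambda>\<omega>. Im (Z \<omega>)) std_normal_density \<and>
    prob_space.indep_var P borel (\<lambda>\<omega>. Re (Z \<omega>)) borel (\<lambda>\<omega>. Im (Z \<omega>))"

definition gaussian_noise :: "'w measure \<Rightarrow> (int \<Rightarrow> 'w \<Rightarrow> complex) \<Rightarrow> bool"
  where "gaussian_noise P \<xi> \<longleftrightarrow> prob_space P \<and>
    prob_space.indep_vars P (\<lambda>_. borel) \<xi> UNIV \<and> (\<forall>n. std_complex_gaussian P (\<xi> n))"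

text \<open>
  \<open>borel :: (int \<Rightarrow> complex) measure\<close> is the Borel sigma-algebra of the product topology.
\<close>

definition admits_recovery ::
    "'w measure \<Rightarrow> (int \<Rightarrow> 'w \<Rightarrow> complex) \<Rightarrow> (int \<Rightarrow> complex) set \<Rightarrow> bool"
  where "admits_recovery P \<xi> X \<longleftrightarrow>
    (\<exists>T :: (int \<Rightarrow> complex) \<Rightarrow> (int \<Rightarrow> complex). T \<in> borel \<rightarrow>\<^sub>M borel \<and>
      (\<forall>x\<in>X. AE \<omega> in P. T (\<lambda>n. x n + \<xi> n \<omega>) = x))"

definition admits_detection ::
    "'w measure \<Rightarrow> (int \<Rightarrow> 'w \<Rightarrow> complex) \<Rightarrow> (int \<Rightarrow> complex) set \<Rightarrow> bool"
  where "admits_detection P \<xi> X \<longleftrightarrow>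
    (\<exists>T :: (int \<Rightarrow> complex) \<Rightarrow> nat. T \<in> borel \<rightarrow>\<^sub>M count_space {0, 1} \<and>
      (AE \<omega> in P. T (\<lambda>n. \<xi> n \<omega>) = 0) \<and>
      (\<forall>x\<in>X. AE \<omega> in P. T (\<lambda>n. x n + \<xi> n \<omega>) = 1))"

end

theory Submission
  imports Defs "HOL-Real_Asymp.Real_Asymp"
begin

text \<open>
  (i) For a trigonometric polynomial \<open>p\<close> with coefficients \<open>c\<^sub>j\<close>, applying the functional
  \<open>y \<mapsto> \<Sum>j. c\<^sub>j y\<^bsub>n-j\<^esub>\<close> to the noisy transform of \<open>\<mu>\<close> gives \<open>\<integral> p e\<^bsub>-n\<^esub> d\<mu>\<close> plus a centred
  Gaussian whose variance is proportional to the squared \<open>L\<^sup>2\<close> norm of \<open>p\<close>. Cover the null set \<open>E\<close> by open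
  sets \<open>U\<^sub>k\<close> of measure at most \<open>4\<^sup>-\<^sup>k\<close>, and let polynomials \<open>p\<^bsub>k,m\<^esub>\<close> converge to the indicator of
  \<open>U\<^sub>k\<close> as \<open>m \<rightarrow> \<infinity>\<close>, boundedly and pointwise, and fast in \<open>L\<^sup>2\<close>. As \<open>m \<rightarrow> \<infinity>\<close> the signal tends to the
  \<open>n\<close>th Fourier coefficient of \<open>\<mu>\<close>, for every \<open>\<mu>\<close> carried by \<open>E\<close>, and the noise converges almost
  surely to a variable of variance \<open>O(4\<^sup>-\<^sup>k)\<close>, which in turn vanishes almost surely as \<open>k \<rightarrow> \<infinity>\<close>. The
  limits are iterated because the rate at which the signal converges depends on \<open>\<mu>\<close>.

  (ii) The Fourier coefficients of Lebesgue measure restricted to \<open>E\<close> form a nonzero square-summable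
  sequence. By Cameron--Martin, shifting the noise by such a sequence yields an absolutely continuous
  law, so the shifted noise cannot be told from the pure noise almost surely.
\<close>

section \<open>Variation of signed and complex measures\<close>

definition signed_measure :: "'a measure \<Rightarrow> ('a set \<Rightarrow> real) \<Rightarrow> bool"
  where "signed_measure M \<nu> \<longleftrightarrow> \<nu> {} = 0 \<and>
    (\<forall>A :: nat \<Rightarrow> 'a set. range A \<subseteq> sets M \<longrightarrow> disjoint_family A \<longrightarrow>
      (\<lambda>n. \<nu> (A n)) sums \<nu> (\<Union>n. A n))"

lemma signed_measureD:
  assumes "signed_measure M \<nu>" "range A \<subseteq> sets M" "disjoint_family A"
  shows "(\<lambda>n. \<nu> (A n)) sums \<nu> (\<Union>n. A n)"
  using assms by (simp add: signed_measure_def)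

lemma signed_measure_uminus: "signed_measure M \<nu> \<Longrightarrow> signed_measure M (\<lambda>A. - \<nu> A)"
  by (simp add: signed_measure_def sums_minus)

lemma complex_measure_Re: "complex_measure M \<mu> \<Longrightarrow> signed_measure M (\<lambda>A. Re (\<mu> A))"
  and complex_measure_Im: "complex_measure M \<mu> \<Longrightarrow> signed_measure M (\<lambda>A. Im (\<mu> A))"
  by (auto simp: complex_measure_def signed_measure_def intro!: sums_Re sums_Im)

lemma signed_measure_Un:
  assumes \<nu>: "signed_measure M \<nu>" and A: "A \<in> sets M" "B \<in> sets M" "A \<inter> B = {}"
  shows "\<nu> (A \<union> B) = \<nu> A + \<nu> B"
proof -
  have "(\<lambda>n. \<nu> (binaryset A B n)) sums \<nu> (\<Union>n. binaryset A B n)"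
    using A by (intro signed_measureD[OF \<nu>]) (auto simp: disjoint_family_on_def binaryset_def)
  moreover have "(\<lambda>n. \<nu> (binaryset A B n)) sums (\<nu> A + \<nu> B)"
    using \<nu> by (intro binaryset_sums) (simp add: signed_measure_def)
  ultimately show ?thesis
    by (simp add: UN_binaryset_eq sums_unique2)
qed

lemma signed_measure_Diff:
  assumes \<nu>: "signed_measure M \<nu>" and A: "A \<in> sets M" "B \<in> sets M" "B \<subseteq> A"
  shows "\<nu> (A - B) = \<nu> A - \<nu> B"
  using signed_measure_Un[OF \<nu>, of "A - B" B] A by (simp add: Un_absorb2 Diff_Int_distrib2)

text \<open>
  If \<open>\<nu>\<close> were unbounded on the subsets of \<open>A\<close>, split \<open>A\<close> by a subset of value exceeding \<open>\<bar>\<nu> A\<bar> + 1\<close>: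
  both pieces have value of modulus more than 1, and \<open>\<nu>\<close> is unbounded on one of them. Iterating
  yields disjoint sets on which \<open>\<nu>\<close> does not tend to 0.
\<close>

lemma signed_measure_bounded:
  assumes \<nu>: "signed_measure M \<nu>"
  shows "\<exists>K. \<forall>A\<in>sets M. \<bar>\<nu> A\<bar> \<le> K"
proof (rule ccontr)
  assume unbounded: "\<not> ?thesis"
  define unb where "unb A \<longleftrightarrow> A \<in> sets M \<and> (\<forall>K. \<exists>B\<in>sets M. B \<subseteq> A \<and> \<bar>\<nu> B\<bar> > K)" for A
  have step: "\<exists>A'. unb A' \<and> A' \<subseteq> A \<and> \<bar>\<nu> (A - A')\<bar> > 1" if A: "unb A" for A
  proof -
    have AM: "A \<in> sets M"
      using A by (simp add: unb_def)
    obtain B where B: "B \<in> sets M" "B \<subseteq> A" "\<bar>\<nu> B\<bar> > \<bar>\<nu> A\<bar> + 1"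
      using A unfolding unb_def by blast
    have d: "\<nu> (A - B) = \<nu> A - \<nu> B"
      using signed_measure_Diff[OF \<nu> AM B(1,2)] .
    have "unb B \<or> unb (A - B)"
    proof (rule ccontr)
      assume "\<not> ?thesis"
      then obtain K L where K: "\<And>C. C \<in> sets M \<Longrightarrow> C \<subseteq> B \<Longrightarrow> \<bar>\<nu> C\<bar> \<le> K"
        and L: "\<And>C. C \<in> sets M \<Longrightarrow> C \<subseteq> A - B \<Longrightarrow> \<bar>\<nu> C\<bar> \<le> L"
        using AM B(1) unfolding unb_def by (meson not_less sets.Diff)
      obtain C where C: "C \<in> sets M" "C \<subseteq> A" "\<bar>\<nu> C\<bar> > K + L"
        using A unfolding unb_def by blast
      have "\<nu> C = \<nu> (C \<inter> B) + \<nu> (C - B)"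
        using signed_measure_Un[OF \<nu>, of "C \<inter> B" "C - B"] C(1) B(1) by (auto simp: Int_Diff_Un)
      moreover have "\<bar>\<nu> (C \<inter> B)\<bar> \<le> K" "\<bar>\<nu> (C - B)\<bar> \<le> L"
        using C B by (auto intro!: K L)
      ultimately show False
        using C(3) by linarith
    qed
    moreover have "A - (A - B) = B"
      using B(2) by auto
    ultimately show ?thesis
      using B d by (auto intro: exI[of _ B] exI[of _ "A - B"])
  qed
  have "unb (space M)"
    using unbounded sets.sets_into_space unfolding unb_def by (metis linorder_not_le sets.top)
  then obtain F where F: "\<And>n. unb (F n)" "\<And>n. F (Suc n) \<subseteq> F n" "\<And>n. \<bar>\<nu> (F n - F (Suc n))\<bar> > 1"
    using dependent_nat_choice[of "\<lambda>_. unb" "\<lambda>_ A A'. A' \<subseteq> A \<and> \<bar>\<nu> (A - A')\<bar> > 1"] step by metis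
  define D where "D n = F n - F (Suc n)" for n
  have dec: "F n \<subseteq> F m" if "m \<le> n" for m n
    using lift_Suc_antimono_le[of F] F(2) that by blast
  have "disjoint_family D"
    unfolding disjoint_family_on_def
  proof (intro ballI impI)
    fix m n :: nat assume "m \<noteq> n"
    then show "D m \<inter> D n = {}"
      using dec[of "Suc m" n] dec[of "Suc n" m] by (cases "m < n") (auto simp: D_def)
  qed
  moreover have "range D \<subseteq> sets M"
    using F(1) by (auto simp: D_def unb_def)
  ultimately have "(\<lambda>n. \<nu> (D n)) \<longlonglongrightarrow> 0"
    using signed_measureD[OF \<nu>] sums_summable summable_LIMSEQ_zero by blast
  then have "\<forall>\<^sub>F n in sequentially. \<bar>\<nu> (D n)\<bar> < 1"
    using order_tendstoD(2)[OF tendsto_rabs_zero] by force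
  then show False
    using F(3) unfolding D_def eventually_sequentially by (metis less_asym order_refl)
qed

text \<open>Coercion to \<open>ennreal\<close> turns negative terms into 0, so the right-hand side
  sums positive parts and only an inequality can hold. It supplies the subadditive half of countable
  additivity of the upper variation.\<close>

lemma ennreal_sums_le_suminf:
  assumes "f sums (s::real)"
  shows "ennreal s \<le> (\<Sum>n. ennreal (f n))"
proof -
  have "(\<lambda>n. ennreal (\<Sum>i<n. f i)) \<longlonglongrightarrow> ennreal s"
    using assms by (intro tendsto_ennrealI) (simp add: sums_def)
  moreover have "ennreal (\<Sum>i<n. f i) \<le> (\<Sum>n. ennreal (f n))" for n
  proof -
    have "ennreal (\<Sum>i<n. f i) \<le> ennreal (\<Sum>i<n. max 0 (f i))"
      by (intro ennreal_leI sum_mono) simp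
    also have "\<dots> = (\<Sum>i<n. ennreal (max 0 (f i)))"
      by (rule sum_ennreal[symmetric]) simp
    also have "\<dots> = (\<Sum>i<n. ennreal (f i))"
      by (intro sum.cong) (auto simp: max_def ennreal_neg)
    also have "\<dots> \<le> (\<Sum>n. ennreal (f n))"
      by (intro sum_le_suminf) auto
    finally show ?thesis .
  qed
  ultimately show ?thesis
    by (intro LIMSEQ_le_const2) auto
qed

text \<open>\<open>measure_of\<close> returns the intended values only for a countably additive set
  function, so this is the existence half of the Jordan decomposition. Superadditivity comes from
  uniting competitors inside disjoint sets. Subadditivity comes from cutting one competitor
  \<open>B\<close> into the pieces \<open>B \<inter> A i\<close>.\<close>

lemma
  assumes \<nu>: "signed_measure M \<nu>"
  shows space_upper_variation: "space (upper_variation M \<nu>) = space M"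
    and sets_upper_variation: "sets (upper_variation M \<nu>) = sets M"
    and emeasure_upper_variation: "\<And>A. A \<in> sets M \<Longrightarrow>
      emeasure (upper_variation M \<nu>) A = (SUP B \<in> {B \<in> sets M. B \<subseteq> A}. ennreal (\<nu> B))"
proof -
  show "space (upper_variation M \<nu>) = space M"
    unfolding upper_variation_def by (rule space_measure_of) (rule sets.space_closed)
  show sets: "sets (upper_variation M \<nu>) = sets M"
    unfolding upper_variation_def by (subst sets_measure_of) (auto simp: sets.sigma_sets_eq sets.space_closed)
  define V where "V A = (SUP B \<in> {B \<in> sets M. B \<subseteq> A}. ennreal (\<nu> B))" for A
  have upper: "ennreal (\<nu> B) \<le> V A" if "B \<in> sets M" "B \<subseteq> A" for A B
    unfolding V_def using that by (intro SUP_upper) auto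
  have nu0: "\<nu> {} = 0"
    using \<nu> by (simp add: signed_measure_def)
  have mono: "V A \<le> V B" if "A \<subseteq> B" for A B
    unfolding V_def using that by (intro SUP_subset_mono) auto
  have "{B \<in> sets M. B \<subseteq> {}} = {{}}"
    by auto
  then have V0: "V {} = 0"
    by (simp add: V_def nu0)
  have V_Un: "V A + V B \<le> V (A \<union> B)" if "A \<inter> B = {}" for A B
  proof -
    have *: "ennreal (\<nu> C) + ennreal (\<nu> D) \<le> V (A \<union> B)"
      if "C \<in> sets M" "C \<subseteq> A" "D \<in> sets M" "D \<subseteq> B" for C D
    \<comment> \<open>A negative value is coerced to 0, and the other set alone is then a competitor
      for \<open>A \<union> B\<close>. Otherwise additivity of \<nu> on the disjoint union
      applies.\<close>
    proof (cases "\<nu> C < 0 \<or> \<nu> D < 0")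
      case True
      then show ?thesis
        using that by (auto simp: ennreal_neg intro!: upper)
    next
      case False
      moreover have "C \<inter> D = {}"
        using that \<open>A \<inter> B = {}\<close> by blast
      ultimately have "ennreal (\<nu> C) + ennreal (\<nu> D) = ennreal (\<nu> (C \<union> D))"
        using signed_measure_Un[OF \<nu>, of C D] that by simp
      then show ?thesis
        using that by (auto intro!: upper)
    qed
    have "V A + ennreal (\<nu> D) \<le> V (A \<union> B)" if "D \<in> sets M" "D \<subseteq> B" for D
      unfolding V_def[of A] using that
      by (subst ennreal_SUP_add_left[symmetric]) (auto intro!: SUP_least *)
    then show ?thesis
      unfolding V_def[of B]
      by (subst ennreal_SUP_add_right) (auto intro!: SUP_least)
  qed
  have "countably_additive (sets M) V"
  proof (rule countably_additiveI)
    fix A :: "nat \<Rightarrow> 'a set"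
    assume A: "range A \<subseteq> sets M" "disjoint_family A"
    have fin: "(\<Sum>i<n. V (A i)) \<le> V (\<Union>i<n. A i)" for n
    proof (induction n)
      case (Suc n)
      have "A i \<inter> A n = {}" if "i < n" for i
        using disjoint_family_onD[OF A(2), of i n] that by simp
      then have "(\<Union>i<n. A i) \<inter> A n = {}"
        by auto
      then have "V (\<Union>i<n. A i) + V (A n) \<le> V ((\<Union>i<n. A i) \<union> A n)"
        by (rule V_Un)
      also have "(\<Union>i<n. A i) \<union> A n = (\<Union>i<Suc n. A i)"
        by (auto simp: lessThan_Suc)
      finally have "V (\<Union>i<n. A i) + V (A n) \<le> V (\<Union>i<Suc n. A i)" .
      moreover have "(\<Sum>i<Suc n. V (A i)) \<le> V (\<Union>i<n. A i) + V (A n)"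
        using Suc by (simp add: add_right_mono)
      ultimately show ?case
        by (rule order_trans[rotated])
    qed (simp add: V0)
    have "(\<Sum>i<n. V (A i)) \<le> V (\<Union>i. A i)" for n
      by (rule order_trans[OF fin mono]) auto
    then have "(\<Sum>i. V (A i)) \<le> V (\<Union>i. A i)"
      by (rule suminf_le_const[OF summableI])
    moreover have "V (\<Union>i. A i) \<le> (\<Sum>i. V (A i))"
      unfolding V_def[of "\<Union>i. A i"]
    proof (intro SUP_least)
      fix B assume "B \<in> {B \<in> sets M. B \<subseteq> (\<Union>i. A i)}"
      then have B: "B \<in> sets M" "B = (\<Union>i. B \<inter> A i)"
        by auto
      have "(\<lambda>i. \<nu> (B \<inter> A i)) sums \<nu> (\<Union>i. B \<inter> A i)"
        using A B(1) by (intro signed_measureD[OF \<nu>]) (auto simp: disjoint_family_on_def)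
      then have "ennreal (\<nu> B) \<le> (\<Sum>i. ennreal (\<nu> (B \<inter> A i)))"
        using ennreal_sums_le_suminf B(2) by metis
      also have "\<dots> \<le> (\<Sum>i. V (A i))"
        using A B(1) by (intro suminf_le upper) auto
      finally show "ennreal (\<nu> B) \<le> (\<Sum>i. V (A i))" .
    qed
    ultimately show "(\<Sum>i. V (A i)) = V (\<Union>i. A i)"
      by (rule antisym)
  qed
  moreover have "upper_variation M \<nu> = measure_of (space M) (sets M) V"
    by (simp add: upper_variation_def V_def[abs_def])
  ultimately have "emeasure (upper_variation M \<nu>) A = V A" if "A \<in> sets M" for A
    using that V0 by (intro emeasure_measure_of[OF _ sets.space_closed]) (simp_all add: sets positive_def)
  then show "emeasure (upper_variation M \<nu>) A = (SUP B \<in> {B \<in> sets M. B \<subseteq> A}. ennreal (\<nu> B))"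
    if "A \<in> sets M" for A
    using that by (simp add: V_def)
qed

lemma finite_measure_upper_variation:
  assumes \<nu>: "signed_measure M \<nu>"
  shows "finite_measure (upper_variation M \<nu>)"
proof
  obtain K where K: "\<forall>A\<in>sets M. \<bar>\<nu> A\<bar> \<le> K"
    using signed_measure_bounded[OF \<nu>] by blast
  have "emeasure (upper_variation M \<nu>) (space M) \<le> ennreal K"
    using K by (subst emeasure_upper_variation[OF \<nu>]) (auto intro!: SUP_least ennreal_leI simp: abs_le_iff)
  then show "emeasure (upper_variation M \<nu>) (space (upper_variation M \<nu>)) \<noteq> \<infinity>"
    by (auto simp: space_upper_variation[OF \<nu>] top_unique)
qed

lemma upper_variation_eq_0:
  assumes \<nu>: "signed_measure M \<nu>" and A: "A \<in> sets M" and "\<And>B. B \<in> sets M \<Longrightarrow> B \<subseteq> A \<Longrightarrow> \<nu> B = 0"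
  shows "emeasure (upper_variation M \<nu>) A = 0"
  using assms(3) by (subst emeasure_upper_variation[OF \<nu> A]) (auto intro!: antisym SUP_least)

text \<open>\<open>B\<close> together with the rest of the complement of \<open>E\<close>, padded by
  empty sets, is one of the partitions in the total variation. The term of \<open>B\<close> is
  therefore at most 0.\<close>

lemma carried_by_imp_null:
  assumes \<mu>: "complex_measure M \<mu>" "carried_by M \<mu> E" and B: "B \<in> sets M" "B \<inter> E = {}" and E: "E \<in> sets M"
  shows "\<mu> B = 0"
proof -
  define A where "A = binaryset B (space M - E - B)"
  have BS: "B \<subseteq> space M"
    using B sets.sets_into_space by auto
  have "range A \<subseteq> sets M \<and> disjoint_family A \<and> (\<Union>n. A n) = space M - E"
    using B E BS unfolding A_def
    by (auto simp: UN_binaryset_eq range_binaryset_eq disjoint_family_on_def binaryset_def)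
  then have "(\<Sum>n. ennreal (cmod (\<mu> (A n)))) \<le> total_variation M \<mu> (space M - E)"
    unfolding total_variation_def by (intro SUP_upper) auto
  also have "\<dots> = 0"
    using \<mu> by (simp add: carried_by_def)
  finally have "ennreal (cmod (\<mu> (A 0))) = 0"
    using sum_le_suminf[of "\<lambda>n. ennreal (cmod (\<mu> (A n)))" "{0}"] by (simp add: summableI)
  then show ?thesis
    by (simp add: A_def binaryset_def)
qed

section \<open>Integration against signed and complex measures\<close>

lemma signed_integral_sum:
  fixes f :: "'i \<Rightarrow> 'a \<Rightarrow> complex"
  assumes \<nu>: "signed_measure M \<nu>"
    and f: "\<And>i. i \<in> I \<Longrightarrow> f i \<in> borel_measurable M" "\<And>i x. i \<in> I \<Longrightarrow> cmod (f i x) \<le> K"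
  shows "signed_integral M \<nu> (\<lambda>x. \<Sum>i\<in>I. c i * f i x) = (\<Sum>i\<in>I. c i * signed_integral M \<nu> (f i))"
proof -
  have *: "integral\<^sup>L (upper_variation M \<eta>) (\<lambda>x. \<Sum>i\<in>I. c i * f i x)
      = (\<Sum>i\<in>I. c i * integral\<^sup>L (upper_variation M \<eta>) (f i))" if \<eta>: "signed_measure M \<eta>" for \<eta>
  proof -
    interpret finite_measure "upper_variation M \<eta>"
      by (rule finite_measure_upper_variation[OF \<eta>])
    have "integrable (upper_variation M \<eta>) (f i)" if "i \<in> I" for i
      using f that by (intro integrable_const_bound[of _ K])
        (auto simp: measurable_cong_sets[OF sets_upper_variation[OF \<eta>] refl])
    then show ?thesis
      by (subst Bochner_Integration.integral_sum) auto
  qed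
  show ?thesis
    unfolding signed_integral_def *[OF \<nu>] *[OF signed_measure_uminus[OF \<nu>]]
    by (simp add: sum_subtractf algebra_simps)
qed

text \<open>Since \<nu> and its negative vanish on all measurable sets disjoint from
  \<open>E\<close>, both upper variations give the complement of \<open>E\<close> mass 0. They are
  finite, so the constant \<open>K\<close> is an integrable dominating function for each of them,
  and convergence on \<open>E\<close> suffices.\<close>

lemma signed_integral_dominated_convergence:
  fixes f :: "nat \<Rightarrow> 'a \<Rightarrow> complex"
  assumes \<nu>: "signed_measure M \<nu>" and E: "E \<in> sets M"
    and null: "\<And>B. B \<in> sets M \<Longrightarrow> B \<inter> E = {} \<Longrightarrow> \<nu> B = 0"
    and f: "\<And>i. f i \<in> borel_measurable M" "\<And>i x. cmod (f i x) \<le> K" and g: "g \<in> borel_measurable M"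
    and lim: "\<And>x. x \<in> E \<Longrightarrow> (\<lambda>i. f i x) \<longlonglongrightarrow> g x"
  shows "(\<lambda>i. signed_integral M \<nu> (f i)) \<longlonglongrightarrow> signed_integral M \<nu> g"
proof -
  have *: "(\<lambda>i. integral\<^sup>L (upper_variation M \<eta>) (f i)) \<longlonglongrightarrow> integral\<^sup>L (upper_variation M \<eta>) g"
    if \<eta>: "signed_measure M \<eta>" and null: "\<And>B. B \<in> sets M \<Longrightarrow> B \<inter> E = {} \<Longrightarrow> \<eta> B = 0" for \<eta>
  proof -
    note [simp] = measurable_cong_sets[OF sets_upper_variation[OF \<eta>] refl]
    interpret finite_measure "upper_variation M \<eta>"
      by (rule finite_measure_upper_variation[OF \<eta>])
    have "AE x in upper_variation M \<eta>. x \<in> E"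
    proof (rule AE_I)
      show "emeasure (upper_variation M \<eta>) (space M - E) = 0"
        using E by (intro upper_variation_eq_0[OF \<eta>] null) auto
    qed (use E in \<open>auto simp: space_upper_variation[OF \<eta>] sets_upper_variation[OF \<eta>]\<close>)
    then show ?thesis
      by (intro integral_dominated_convergence[where w = "\<lambda>_. K"]) (auto simp: f g lim elim!: eventually_mono)
  qed
  show ?thesis
    unfolding signed_integral_def
    by (intro tendsto_diff *[OF \<nu>] *[OF signed_measure_uminus[OF \<nu>]]) (auto simp: null)
qed

lemma complex_integral_sum:
  fixes f :: "'i \<Rightarrow> 'a \<Rightarrow> complex"
  assumes "complex_measure M \<mu>"
    and "\<And>i. i \<in> I \<Longrightarrow> f i \<in> borel_measurable M" "\<And>i x. i \<in> I \<Longrightarrow> cmod (f i x) \<le> K"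
  shows "complex_integral M \<mu> (\<lambda>x. \<Sum>i\<in>I. c i * f i x) = (\<Sum>i\<in>I. c i * complex_integral M \<mu> (f i))"
proof -
  have *: "signed_integral M \<nu> (\<lambda>x. \<Sum>i\<in>I. c i * f i x) = (\<Sum>i\<in>I. c i * signed_integral M \<nu> (f i))"
    if "signed_measure M \<nu>" for \<nu>
    using that assms(2,3) by (rule signed_integral_sum)
  show ?thesis
    unfolding complex_integral_def *[OF complex_measure_Re[OF assms(1)]]
      *[OF complex_measure_Im[OF assms(1)]]
    by (simp add: sum_distrib_left sum.distrib algebra_simps)
qed

lemma complex_integral_dominated_convergence:
  fixes f :: "nat \<Rightarrow> 'a \<Rightarrow> complex"
  assumes \<mu>: "complex_measure M \<mu>" "carried_by M \<mu> E" and E: "E \<in> sets M"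
    and f: "\<And>i. f i \<in> borel_measurable M" "\<And>i x. cmod (f i x) \<le> K" and g: "g \<in> borel_measurable M"
    and lim: "\<And>x. x \<in> E \<Longrightarrow> (\<lambda>i. f i x) \<longlonglongrightarrow> g x"
  shows "(\<lambda>i. complex_integral M \<mu> (f i)) \<longlonglongrightarrow> complex_integral M \<mu> g"
  unfolding complex_integral_def
  using carried_by_imp_null[OF \<mu> _ _ E]
  by (intro tendsto_intros signed_integral_dominated_convergence[OF complex_measure_Re[OF \<mu>(1)] E _ f g lim]
      signed_integral_dominated_convergence[OF complex_measure_Im[OF \<mu>(1)] E _ f g lim]) auto

text \<open>For a finite positive measure the supremum is attained at the whole set, and the
  negative part is 0 because negative values are coerced to 0. This makes the complex integral
  against a positive measure an ordinary integral.\<close>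

lemma upper_variation_measure:
  assumes "finite_measure M"
  shows "upper_variation M (measure M) = M" "upper_variation M (\<lambda>A. - measure M A) = null_measure M"
    "upper_variation M (\<lambda>A. 0) = null_measure M"
proof -
  interpret finite_measure M by fact
  have sm: "signed_measure M (measure M)"
    unfolding signed_measure_def using finite_measure_UNION by auto
  have sm0: "signed_measure M (\<lambda>A. 0)"
    by (simp add: signed_measure_def)
  show "upper_variation M (measure M) = M"
  proof (rule measure_eqI)
    fix A assume "A \<in> sets (upper_variation M (measure M))"
    then have A: "A \<in> sets M"
      by (simp add: sets_upper_variation[OF sm])
    show "emeasure (upper_variation M (measure M)) A = emeasure M A"
      unfolding emeasure_upper_variation[OF sm A] emeasure_eq_measure
      using A by (intro antisym SUP_least SUP_upper ennreal_leI finite_measure_mono) auto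
  qed (rule sets_upper_variation[OF sm])
  show "upper_variation M (\<lambda>A. - measure M A) = null_measure M"
  proof (rule measure_eqI)
    fix A assume "A \<in> sets (upper_variation M (\<lambda>A. - measure M A))"
    then have A: "A \<in> sets M"
      by (simp add: sets_upper_variation[OF signed_measure_uminus[OF sm]])
    show "emeasure (upper_variation M (\<lambda>A. - measure M A)) A = emeasure (null_measure M) A"
      unfolding emeasure_upper_variation[OF signed_measure_uminus[OF sm] A]
      by (auto simp: ennreal_neg intro!: antisym SUP_least)
  qed (simp add: sets_upper_variation[OF signed_measure_uminus[OF sm]])
  show "upper_variation M (\<lambda>A. 0) = null_measure M"
  proof (rule measure_eqI)
    fix A assume "A \<in> sets (upper_variation M (\<lambda>A. 0))"
    then have A: "A \<in> sets M"
      by (simp add: sets_upper_variation[OF sm0])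
    show "emeasure (upper_variation M (\<lambda>A. 0)) A = emeasure (null_measure M) A"
      unfolding emeasure_upper_variation[OF sm0 A] by (auto intro!: antisym SUP_least)
  qed (simp add: sets_upper_variation[OF sm0])
qed

text \<open>\<open>upper_variation\<close> takes only the sigma-algebra from its first argument.
  Hence \<open>borel\<close> can be exchanged for a concrete measure on the same sets, as
  \<open>complex_integral_measure\<close> requires.\<close>

lemma upper_variation_cong_sets: "sets M = sets N \<Longrightarrow> upper_variation M = upper_variation N"
  by (auto simp: upper_variation_def fun_eq_iff dest: sets_eq_imp_space_eq)

lemma complex_integral_measure:
  assumes "finite_measure M"
  shows "complex_integral M (\<lambda>A. of_real (measure M A)) f = integral\<^sup>L M f"
  by (simp add: complex_integral_def signed_integral_def upper_variation_measure[OF assms])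

section \<open>Characters and trigonometric polynomials\<close>

lemma circle_char_to_circle: "circle_char n (to_circle t) = cis (2 * pi * of_int n * t)"
  by (simp add: circle_char.abs_eq cis_conv_exp algebra_simps)

lemma circle_cases:
  obtains t where "x = to_circle t" "0 \<le> t" "t < 1"
proof -
  have "x = to_circle (rep_circle x)"
    by (simp add: Quotient3_abs_rep[OF Quotient3_circle])
  also have "\<dots> = to_circle (frac (rep_circle x))"
    by (simp add: circle.abs_eq_iff frac_def)
  finally show ?thesis
    using that frac_ge_0 frac_lt_1 by blast
qed

lemma circle_char_0 [simp]: "circle_char 0 x = 1"
  by (cases x rule: circle_cases) (simp add: circle_char_to_circle)

lemma circle_char_add: "circle_char (m + n) x = circle_char m x * circle_char n x"
  by (cases x rule: circle_cases) (simp add: circle_char_to_circle cis_mult algebra_simps)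

lemma cnj_circle_char: "cnj (circle_char n x) = circle_char (- n) x"
  by (cases x rule: circle_cases) (simp add: circle_char_to_circle cis_cnj)

lemma norm_circle_char [simp]: "cmod (circle_char n x) = 1"
  by (cases x rule: circle_cases) (simp add: circle_char_to_circle)

lemma circle_char_nonzero [simp]: "circle_char n x \<noteq> 0"
  by (metis norm_circle_char norm_zero zero_neq_one)

lemma measurable_circle_char [measurable]: "circle_char n \<in> borel_measurable borel"
proof (intro borel_measurable_continuous_onI)
  have "continuous_on UNIV (\<lambda>t. circle_char n (to_circle t))"
    unfolding circle_char.abs_eq by (intro continuous_intros)
  then show "continuous_on UNIV (circle_char n)"
    by (simp add: continuous_on_open_vimage open_circle_def vimage_def)
qed

lemma sets_circle_lebesgue [simp, measurable_cong]: "sets circle_lebesgue = sets borel"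
  by (simp add: circle_lebesgue_def)

lemma space_circle_lebesgue [simp]: "space circle_lebesgue = UNIV"
  by (simp add: circle_lebesgue_def)

lemma prob_space_circle_lebesgue: "prob_space circle_lebesgue"
proof
  have "emeasure circle_lebesgue UNIV = emeasure lborel {0..<1::real}"
    by (subst emeasure_circle_lebesgue) (auto simp: atLeastLessThan_def intro!: arg_cong[of _ _ "emeasure lborel"])
  then show "emeasure circle_lebesgue (space circle_lebesgue) = 1"
    by simp
qed

interpretation circle_lebesgue: prob_space circle_lebesgue
  by (rule prob_space_circle_lebesgue)

lemma integral_circle_char: "(\<integral>x. circle_char n x \<partial>circle_lebesgue) = (if n = 0 then 1 else 0)"
proof (cases "n = 0")
  case False
  define a where "a = 2 * of_real pi * \<i> * complex_of_int n"
  have a: "a \<noteq> 0"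
    using False by (simp add: a_def)
  have "(\<integral>x. circle_char n x \<partial>circle_lebesgue)
      = (\<integral>t. circle_char n (to_circle t) \<partial>restrict_space lborel {0..<1})"
    unfolding circle_lebesgue_def by (intro integral_distr measurable_restrict_space1) auto
  also have "\<dots> = (\<integral>t. indicator {0..<1} t *\<^sub>R exp (a * of_real t) \<partial>lborel)"
    by (subst integral_restrict_space) (auto simp: circle_char.abs_eq a_def)
  \<comment> \<open>The right endpoint is a null set; adding it gives the compact interval of the
    fundamental theorem of calculus.\<close>
  also have "\<dots> = (\<integral>t. indicator {0..1} t *\<^sub>R exp (a * of_real t) \<partial>lborel)"
    using AE_lborel_singleton[of "1::real"]
    by (intro integral_cong_AE) (auto simp: indicator_def elim!: eventually_mono)
  also have "\<dots> = exp (a * of_real 1) / a - exp (a * of_real 0) / a"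
  proof (rule integral_FTC_Icc)
    fix t :: real
    have "((\<lambda>w. exp (a * w) / a) has_field_derivative exp (a * of_real t)) (at (of_real t))"
      using a by (auto intro!: derivative_eq_intros)
    from has_vector_derivative_real_field[OF this]
    show "((\<lambda>t. exp (a * of_real t) / a) has_vector_derivative exp (a * of_real t)) (at t within {0..1})"
      by (rule has_vector_derivative_at_within)
  qed (auto intro!: continuous_intros)
  also have "\<dots> = 0"
    by (simp add: a_def exp_eq_1 algebra_simps)
  finally show ?thesis
    using False by simp
qed (use circle_lebesgue.prob_space in simp)

lemma integrable_circle_char: "integrable circle_lebesgue (circle_char n)"
  by (rule circle_lebesgue.integrable_const_bound[of _ 1]) auto

lemma circle_char_orthonormal:
  "(\<integral>x. circle_char i x * cnj (circle_char j x) \<partial>circle_lebesgue) = (if i = j then 1 else 0)"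
  "integrable circle_lebesgue (\<lambda>x. circle_char i x * cnj (circle_char j x))"
  unfolding cnj_circle_char circle_char_add[symmetric]
  by (auto simp: integral_circle_char integrable_circle_char)

lemma
  fixes X :: "'i \<Rightarrow> 'a \<Rightarrow> complex"
  assumes "\<And>i j. integrable M (\<lambda>x. X i x * cnj (X j x))"
    and "\<And>i j. (\<integral>x. X i x * cnj (X j x) \<partial>M) = (if i = j then of_real a else 0)"
    and J: "finite J"
  shows integrable_norm_sum_orthogonal: "integrable M (\<lambda>x. (cmod (\<Sum>j\<in>J. c j * X j x))\<^sup>2)"
    and integral_norm_sum_orthogonal:
      "(\<integral>x. (cmod (\<Sum>j\<in>J. c j * X j x))\<^sup>2 \<partial>M) = a * (\<Sum>j\<in>J. (cmod (c j))\<^sup>2)"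
proof -
  \<comment> \<open>The squared norm is embedded into the complex numbers so that it can be expanded
    as a double sum of complex products; the identity is brought back to the reals at the
    end.\<close>
  have eq: "complex_of_real ((cmod (\<Sum>j\<in>J. c j * X j x))\<^sup>2)
      = (\<Sum>i\<in>J. \<Sum>j\<in>J. c i * cnj (c j) * (X i x * cnj (X j x)))" for x
    by (simp only: complex_norm_square cnj_sum complex_cnj_mult sum_product mult_ac)
  have int: "integrable M (\<lambda>x. complex_of_real ((cmod (\<Sum>j\<in>J. c j * X j x))\<^sup>2))"
    unfolding eq using assms by (intro Bochner_Integration.integrable_sum integrable_mult_right) auto
  then show "integrable M (\<lambda>x. (cmod (\<Sum>j\<in>J. c j * X j x))\<^sup>2)"
    using integrable_Re by fastforce
  have "complex_of_real (\<integral>x. (cmod (\<Sum>j\<in>J. c j * X j x))\<^sup>2 \<partial>M)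
      = (\<Sum>i\<in>J. \<Sum>j\<in>J. c i * cnj (c j) * (if i = j then of_real a else 0))"
    unfolding integral_complex_of_real[symmetric] eq
    using assms by (simp add: Bochner_Integration.integral_sum)
  also have "\<dots> = of_real (a * (\<Sum>j\<in>J. (cmod (c j))\<^sup>2))"
    using J by (simp add: if_distrib sum.delta sum_distrib_left mult_ac cong: if_cong del: of_real_power)
      (simp only: complex_norm_square mult_ac)
  finally show "(\<integral>x. (cmod (\<Sum>j\<in>J. c j * X j x))\<^sup>2 \<partial>M) = a * (\<Sum>j\<in>J. (cmod (c j))\<^sup>2)"
    by (simp only: of_real_eq_iff)
qed

section \<open>Trigonometric polynomials and their approximation of indicators\<close>

definition trig_poly :: "(circle \<Rightarrow> complex) \<Rightarrow> bool"
  where "trig_poly f \<longleftrightarrow> (\<exists>J c. finite J \<and> f = (\<lambda>x. \<Sum>j\<in>J. c j * circle_char j x))"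

lemma trig_poly_char: "trig_poly (\<lambda>x. a * circle_char j x)"
  unfolding trig_poly_def by (intro exI[of _ "{j}"] exI[of _ "\<lambda>_. a"]) auto

lemma trig_poly_const: "trig_poly (\<lambda>x. a)"
  using trig_poly_char[of a 0] by simp

lemma trig_poly_add:
  assumes "trig_poly f" "trig_poly g"
  shows "trig_poly (\<lambda>x. f x + g x)"
proof -
  obtain J c K d where J: "finite J" "f = (\<lambda>x. \<Sum>j\<in>J. c j * circle_char j x)"
    and K: "finite K" "g = (\<lambda>x. \<Sum>j\<in>K. d j * circle_char j x)"
    using assms unfolding trig_poly_def by blast
  have "(\<Sum>j\<in>J \<union> K. ((if j \<in> J then c j else 0) + (if j \<in> K then d j else 0)) * circle_char j x) = f x + g x" for x
  proof -
    have "(\<Sum>j\<in>J \<union> K. (if j \<in> J then c j else 0) * circle_char j x) = f x"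
      unfolding J(2) by (rule sum.mono_neutral_cong_right) (use J K in auto)
    moreover have "(\<Sum>j\<in>J \<union> K. (if j \<in> K then d j else 0) * circle_char j x) = g x"
      unfolding K(2) by (rule sum.mono_neutral_cong_right) (use J K in auto)
    ultimately show ?thesis
      by (simp add: distrib_right sum.distrib)
  qed
  then show ?thesis
    unfolding trig_poly_def using J(1) K(1)
    by (intro exI[of _ "J \<union> K"] exI[of _ "\<lambda>j. (if j \<in> J then c j else 0) + (if j \<in> K then d j else 0)"]) auto
qed

lemma trig_poly_sum: "finite I \<Longrightarrow> (\<And>i. i \<in> I \<Longrightarrow> trig_poly (f i)) \<Longrightarrow> trig_poly (\<lambda>x. \<Sum>i\<in>I. f i x)"
  by (induction I rule: finite_induct) (auto intro: trig_poly_const trig_poly_add)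

lemma trig_poly_mult:
  assumes "trig_poly f" "trig_poly g"
  shows "trig_poly (\<lambda>x. f x * g x)"
proof -
  obtain J c K d where J: "finite J" "f = (\<lambda>x. \<Sum>j\<in>J. c j * circle_char j x)"
    and K: "finite K" "g = (\<lambda>x. \<Sum>j\<in>K. d j * circle_char j x)"
    using assms unfolding trig_poly_def by blast
  have eq: "f x * g x = (\<Sum>i\<in>J. \<Sum>j\<in>K. (c i * d j) * circle_char (i + j) x)" for x
    unfolding J K by (simp add: sum_product circle_char_add mult_ac)
  show ?thesis
    unfolding eq using J(1) K(1) by (intro trig_poly_sum trig_poly_char)
qed

lemma trig_poly_measurable: "trig_poly f \<Longrightarrow> f \<in> borel_measurable borel"
  unfolding trig_poly_def by (elim exE conjE) simp

text \<open>Stone--Weierstrass on the unit circle. The algebra \<open>R\<close> consists of real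
  functions, but their pullbacks may have complex coefficients; the coordinates \<open>Re\<close>
  and \<open>Im\<close> lie in it and separate points.\<close>

lemma trig_poly_dense:
  assumes f: "continuous_on (sphere 0 1) (f :: complex \<Rightarrow> real)" and e: "e > 0"
  obtains p where "trig_poly p" "\<And>x. cmod (p x - of_real (f (circle_char 1 x))) < e"
proof -
  define R :: "(complex \<Rightarrow> real) set"
    where "R = {g. continuous_on (sphere 0 1) g \<and> trig_poly (\<lambda>x. of_real (g (circle_char 1 x)))}"
  have Re: "Re \<in> R"
  proof -
    have "(\<lambda>x. complex_of_real (Re (circle_char 1 x)))
        = (\<lambda>x. 1/2 * circle_char 1 x + 1/2 * circle_char (- 1) x)"
      by (auto simp: cnj_circle_char[symmetric] complex_eq_iff)
    moreover have "trig_poly \<dots>"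
      by (intro trig_poly_add trig_poly_char)
    ultimately show ?thesis
      unfolding R_def by (simp add: continuous_on_Re)
  qed
  have Im: "Im \<in> R"
  proof -
    have "(\<lambda>x. complex_of_real (Im (circle_char 1 x)))
        = (\<lambda>x. - \<i>/2 * circle_char 1 x + \<i>/2 * circle_char (- 1) x)"
      by (auto simp: cnj_circle_char[symmetric] complex_eq_iff)
    moreover have "trig_poly \<dots>"
      by (intro trig_poly_add trig_poly_char)
    ultimately show ?thesis
      unfolding R_def by (simp add: continuous_on_Im)
  qed
  interpret function_ring_on R "sphere 0 1"
  proof
    fix x y :: complex assume "x \<noteq> y"
    then show "\<exists>g\<in>R. g x \<noteq> g y"
      using Re Im by (auto simp: complex_eq_iff)
  qed (auto simp: R_def intro!: continuous_intros trig_poly_add trig_poly_mult trig_poly_const)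
  obtain g where g: "g \<in> R" "\<And>z. z \<in> sphere 0 1 \<Longrightarrow> \<bar>f z - g z\<bar> < e"
    using Stone_Weierstrass_basic[OF f e] by blast
  show ?thesis
  proof (rule that)
    show "trig_poly (\<lambda>x. of_real (g (circle_char 1 x)))"
      using g(1) by (simp add: R_def)
    show "cmod (complex_of_real (g (circle_char 1 x)) - of_real (f (circle_char 1 x))) < e" for x
      using g(2)[of "circle_char 1 x"] by (simp add: of_real_diff[symmetric] abs_minus_commute del: of_real_diff)
  qed
qed

text \<open>The functions \<open>min 1 (m * infdist z (- U))\<close> are continuous, bounded by 1
  and tend to the indicator of the open set \<open>U\<close>. Uniform approximation of the
  \<open>m\<close>th one within \<open>1 / Suc m\<close> keeps the limit and gives the bound
  2.\<close>

lemma trig_poly_tendsto_indicator: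
  assumes U: "open U" "0 \<notin> U"
  obtains p where "\<And>m::nat. trig_poly (p m)" "\<And>m x. cmod (p m x) \<le> 2"
    "\<And>x. (\<lambda>m. p m x) \<longlonglongrightarrow> indicator U (circle_char 1 x)"
proof -
  define f :: "nat \<Rightarrow> complex \<Rightarrow> real" where "f m z = min 1 (real m * infdist z (- U))" for m z
  have f: "continuous_on (sphere 0 1) (f m)" for m
    unfolding f_def by (intro continuous_intros)
  have "\<exists>p. trig_poly p \<and> (\<forall>x. cmod (p x - of_real (f m (circle_char 1 x))) < 1 / Suc m)" for m
    using trig_poly_dense[OF f, of "1 / Suc m" m] by (metis of_nat_0_less_iff zero_less_Suc zero_less_divide_1_iff)
  then obtain p where p: "\<And>m. trig_poly (p m)"
    "\<And>m x. cmod (p m x - of_real (f m (circle_char 1 x))) < 1 / Suc m"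
    by metis
  show ?thesis
  proof (rule that)
    fix m :: nat and x :: circle
    have "cmod (p m x) \<le> cmod (of_real (f m (circle_char 1 x))) + cmod (p m x - of_real (f m (circle_char 1 x)))"
      using norm_triangle_ineq[of "of_real (f m (circle_char 1 x))" "p m x - of_real (f m (circle_char 1 x))"]
      by simp
    also have "\<dots> \<le> 1 + 1 / Suc m"
      using p(2)[of m x] by (intro add_mono) (auto simp: f_def infdist_nonneg)
    also have "\<dots> \<le> 2"
      by (simp add: field_simps)
    finally show "cmod (p m x) \<le> 2" .
  next
    fix x :: circle
    let ?z = "circle_char 1 x"
    have "(\<lambda>m. p m x - of_real (f m ?z)) \<longlonglongrightarrow> 0"
      by (rule Lim_null_comparison[OF _ LIMSEQ_inverse_real_of_nat])
        (use p(2)[of _ x] in \<open>auto simp: inverse_eq_divide intro!: always_eventually less_imp_le\<close>)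
    moreover have "(\<lambda>m. f m ?z) \<longlonglongrightarrow> indicator U ?z"
    proof (cases "?z \<in> U")
      case True
      \<comment> \<open>\<open>infdist\<close> to the empty set is 0 by convention, so the
        complement of \<open>U\<close> has to be nonempty; it contains 0.\<close>
      then have "infdist ?z (- U) > 0"
        using U by (intro infdist_pos_not_in_closed) auto
      then have "\<forall>\<^sub>F m in sequentially. real m * infdist ?z (- U) \<ge> 1"
        by real_asymp
      then have "\<forall>\<^sub>F m in sequentially. f m ?z = 1"
        by eventually_elim (simp add: f_def)
      then show ?thesis
        using True by (simp add: tendsto_eventually)
    qed (simp add: f_def)
    then have "(\<lambda>m. complex_of_real (f m ?z)) \<longlonglongrightarrow> of_real (indicator U ?z)"
      by (rule tendsto_of_real)
    ultimately have "(\<lambda>m. (p m x - of_real (f m ?z)) + of_real (f m ?z)) \<longlonglongrightarrow> 0 + of_real (indicator U ?z)"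
      by (rule tendsto_add)
    then show "(\<lambda>m. p m x) \<longlonglongrightarrow> indicator U ?z"
      by (cases "?z \<in> U") simp_all
  qed (rule p(1))
qed

text \<open>
  Regularity of Borel measures is only available on metric spaces, so the circle is embedded
  into the complex plane by \<open>circle_char 1\<close>.
\<close>

lemma circle_lebesgue_null_cover:
  assumes E: "E \<in> sets borel" "emeasure circle_lebesgue E = 0" and \<delta>: "\<delta> > 0"
  obtains U where "open U" "0 \<notin> U" "\<And>x. x \<in> E \<Longrightarrow> circle_char 1 x \<in> U"
    "measure circle_lebesgue {x. circle_char 1 x \<in> U} \<le> \<delta>"
proof -
  \<comment> \<open>\<open>g\<close> is a Borel left inverse of \<open>circle_char 1\<close>.
    \<open>Arg\<close> is continuous off the closed negative half-axis, and on the negative reals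
    its value is pi, so the case distinction changes nothing on the unit circle and makes
    measurability immediate.\<close>
  define g :: "complex \<Rightarrow> circle"
    where "g z = to_circle ((if z \<in> - \<real>\<^sub>\<le>\<^sub>0 then Arg z else pi) / (2 * pi))" for z
  have g: "g \<in> borel_measurable borel"
    unfolding g_def
    by (intro measurable_compose[OF _ measurable_to_circle] borel_measurable_divide borel_measurable_const
        borel_measurable_continuous_on_if continuous_on_Arg continuous_on_const borel_open) auto
  have g_inv: "g (circle_char 1 x) = x" for x
  proof (cases x rule: circle_cases)
    case (1 t)
    define z where "z = circle_char 1 x"
    have z: "z = cis (2 * pi * t)"
      by (simp add: z_def 1 circle_char_to_circle)
    have arg: "(if z \<in> - \<real>\<^sub>\<le>\<^sub>0 then Arg z else pi) = Arg z"
      using Arg_eq_pi[of z] norm_circle_char[of 1 x]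
      by (auto simp: z_def[symmetric] complex_nonpos_Reals_iff complex_is_Real_iff less_le cmod_def)
    have "cis (Arg z) = cis (2 * pi * t)"
      using cis_Arg[of z] z by (auto simp: sgn_eq)
    then obtain k :: int where "Arg z = 2 * pi * t + 2 * pi * k"
      unfolding cis_conv_exp exp_eq by (auto simp: complex_eq_iff)
    then have "Arg z / (2 * pi) - t = of_int k"
      by (simp add: field_simps)
    then show ?thesis
      unfolding g_def z_def[symmetric] arg by (simp add: 1 circle.abs_eq_iff)
  qed
  define \<rho> where "\<rho> = distr circle_lebesgue borel (circle_char 1)"
  interpret \<rho>: prob_space \<rho>
    unfolding \<rho>_def by (rule circle_lebesgue.prob_space_distr) simp
  have em: "emeasure \<rho> A = emeasure circle_lebesgue {x. circle_char 1 x \<in> A}" if "A \<in> sets borel" for A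
    unfolding \<rho>_def using that by (subst emeasure_distr) (auto simp: vimage_def)
  \<comment> \<open>The preimage under \<open>g\<close> is a Borel set in the plane that pulls back
    to exactly \<open>E\<close>, so it is null for the image measure \<rho>.\<close>
  define E' where "E' = g -` E"
  have E': "E' \<in> sets borel"
    using measurable_sets[OF g E(1)] by (simp add: E'_def)
  have "emeasure \<rho> E' = 0"
    using E by (simp add: em[OF E']) (simp add: E'_def g_inv)
  then have "(INF U \<in> {U. E' \<subseteq> U \<and> open U}. emeasure \<rho> U) < ennreal \<delta>"
    using outer_regular[of \<rho> E'] E' \<delta> by (simp add: \<rho>_def \<rho>.emeasure_finite[unfolded \<rho>_def])
  then obtain U where U: "E' \<subseteq> U" "open U" "emeasure \<rho> U < ennreal \<delta>"
    by (auto simp: INF_less_iff)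
  show ?thesis
  proof (rule that)
    \<comment> \<open>Characters never vanish, so removing 0 leaves the pullback of \<open>U\<close>
      unchanged.\<close>
    show "open (U - {0})"
      using U(2) by auto
    show "circle_char 1 x \<in> U - {0}" if "x \<in> E" for x
      using that U(1) by (auto simp: E'_def g_inv subset_iff)
    have "emeasure circle_lebesgue {x. circle_char 1 x \<in> U - {0}} = emeasure \<rho> U"
      using U(2) by (simp add: em)
    then show "measure circle_lebesgue {x. circle_char 1 x \<in> U - {0}} \<le> \<delta>"
      using U(3) \<delta> by (simp add: measure_def enn2real_leI less_imp_le)
  qed simp
qed

lemma norm_add_square_le: "(cmod (a + b))\<^sup>2 \<le> 2 * (cmod a)\<^sup>2 + 2 * (cmod b)\<^sup>2"
proof -
  have "(cmod (a + b))\<^sup>2 \<le> (cmod a + cmod b)\<^sup>2"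
    by (intro power_mono norm_triangle_ineq) auto
  also have "\<dots> \<le> 2 * (cmod a)\<^sup>2 + 2 * (cmod b)\<^sup>2"
    using sum_squares_bound[of "cmod a" "cmod b"] by (simp add: power2_sum)
  finally show ?thesis .
qed

text \<open>Bounded pointwise convergence to the indicator of a small open cover gives
  \<open>L\<^sup>2\<close> convergence, and thinning the sequence makes the squared error at most
  \<open>\<delta> / 8 ^ m\<close>. Comparing with the indicator through
  \<open>norm_add_square_le\<close> yields both bounds with the constant 4.\<close>

lemma trig_poly_approximants:
  assumes E: "E \<in> sets borel" "emeasure circle_lebesgue E = 0" and \<delta>: "\<delta> > 0"
  obtains p where "\<And>m::nat. trig_poly (p m)" "\<And>m x. cmod (p m x) \<le> 2"
    "\<And>x. x \<in> E \<Longrightarrow> (\<lambda>m. p m x) \<longlonglongrightarrow> 1"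
    "\<And>m. (\<integral>x. (cmod (p m x))\<^sup>2 \<partial>circle_lebesgue) \<le> 4 * \<delta>"
    "\<And>m. (\<integral>x. (cmod (p (Suc m) x - p m x))\<^sup>2 \<partial>circle_lebesgue) \<le> 4 * \<delta> / 8 ^ m"
proof -
  obtain U where U: "open U" "0 \<notin> U" "\<And>x. x \<in> E \<Longrightarrow> circle_char 1 x \<in> U"
    "measure circle_lebesgue {x. circle_char 1 x \<in> U} \<le> \<delta>"
    using circle_lebesgue_null_cover[OF E \<delta>] by blast
  obtain q where q: "\<And>m::nat. trig_poly (q m)" "\<And>m x. cmod (q m x) \<le> 2"
    "\<And>x. (\<lambda>m. q m x) \<longlonglongrightarrow> indicator U (circle_char 1 x)"
    using trig_poly_tendsto_indicator[OF U(1,2)] by blast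
  define u :: "circle \<Rightarrow> complex" where "u x = indicator U (circle_char 1 x)" for x
  have [measurable]: "U \<in> sets borel"
    using U(1) by simp
  have [measurable]: "u \<in> borel_measurable borel"
    unfolding u_def by measurable
  have qm [measurable]: "q m \<in> borel_measurable borel" for m
    by (rule trig_poly_measurable[OF q(1)])
  have ub: "cmod (u x) \<le> 1" for x
    by (simp add: u_def indicator_def)
  \<comment> \<open>The 9 is \<open>(2 + 1)\<^sup>2\<close>, from the bounds on \<open>q\<close> and
    \<open>u\<close>.\<close>
  have bound: "(cmod (q m x - u x))\<^sup>2 \<le> 9" for m x
    using norm_triangle_ineq4[of "q m x" "u x"] q(2)[of m x] ub[of x] power_mono[of "cmod (q m x - u x)" 3 2] by simp
  define D where "D m = (\<integral>x. (cmod (q m x - u x))\<^sup>2 \<partial>circle_lebesgue)" for m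
  have "D \<longlonglongrightarrow> (\<integral>x. 0 \<partial>circle_lebesgue)"
    unfolding D_def
  proof (rule integral_dominated_convergence[where w = "\<lambda>_. 9"])
    have "(\<lambda>m. (cmod (q m x - u x))\<^sup>2) \<longlonglongrightarrow> (cmod (u x - u x))\<^sup>2" for x
      unfolding u_def by (intro tendsto_intros q(3))
    then show "AE x in circle_lebesgue. (\<lambda>m. (cmod (q m x - u x))\<^sup>2) \<longlonglongrightarrow> 0"
      by simp
  qed (use bound in auto)
  then have D: "D \<longlonglongrightarrow> 0"
    by simp
  \<comment> \<open>Requiring \<open>r \<ge> m\<close> forces the chosen indices to infinity, so the
    pointwise limits survive the thinning.\<close>
  have "\<exists>r\<ge>m. D r \<le> \<delta> / 8 ^ m" for m
  proof -
    have "\<forall>\<^sub>F r in sequentially. D r < \<delta> / 8 ^ m"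
      using \<delta> by (intro order_tendstoD(2)[OF D]) simp
    then show ?thesis
      unfolding eventually_sequentially by (metis le_cases less_imp_le order_refl)
  qed
  then obtain r where r: "\<And>m. r m \<ge> m" "\<And>m. D (r m) \<le> \<delta> / 8 ^ m"
    by metis
  have int: "integrable circle_lebesgue (\<lambda>x. (cmod (q m x - u x))\<^sup>2)" for m
    by (rule circle_lebesgue.integrable_const_bound[of _ 9]) (use bound in auto)
  have int_u: "integrable circle_lebesgue (\<lambda>x. (cmod (u x))\<^sup>2)"
    by (rule circle_lebesgue.integrable_const_bound[of _ 1]) (use ub in \<open>auto simp: power_le_one\<close>)
  have "(\<integral>x. (cmod (u x))\<^sup>2 \<partial>circle_lebesgue) = (\<integral>x. indicator {x. circle_char 1 x \<in> U} x \<partial>circle_lebesgue)"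
    by (intro Bochner_Integration.integral_cong) (auto simp: u_def indicator_def)
  also have "\<dots> \<le> \<delta>"
    using U(4) by simp
  finally have u2: "(\<integral>x. (cmod (u x))\<^sup>2 \<partial>circle_lebesgue) \<le> \<delta>" .
  show ?thesis
  proof (rule that[of "\<lambda>m. q (r m)"])
    fix x assume "x \<in> E"
    then have "(\<lambda>m. q m x) \<longlonglongrightarrow> 1"
      using q(3)[of x] U(3) by simp
    moreover have "filterlim r sequentially sequentially"
      using r(1) by (intro filterlim_at_top_mono[OF filterlim_ident]) auto
    ultimately show "(\<lambda>m. q (r m) x) \<longlonglongrightarrow> 1"
      by (rule filterlim_compose)
  next
    fix m
    have "(\<integral>x. (cmod (q (r m) x))\<^sup>2 \<partial>circle_lebesgue)
        \<le> (\<integral>x. 2 * (cmod (q (r m) x - u x))\<^sup>2 + 2 * (cmod (u x))\<^sup>2 \<partial>circle_lebesgue)"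
    proof (rule integral_mono_AE')
      show "AE x in circle_lebesgue. (cmod (q (r m) x))\<^sup>2 \<le> 2 * (cmod (q (r m) x - u x))\<^sup>2 + 2 * (cmod (u x))\<^sup>2"
        using norm_add_square_le[of "q (r m) x - u x" "u x" for x] by simp
    qed (use int int_u in auto)
    also have "\<dots> = 2 * D (r m) + 2 * (\<integral>x. (cmod (u x))\<^sup>2 \<partial>circle_lebesgue)"
      using int int_u by (simp add: D_def)
    also have "\<dots> \<le> 2 * (\<delta> / 8 ^ m) + 2 * \<delta>"
      using r(2)[of m] u2 by simp
    also have "\<dots> \<le> 4 * \<delta>"
      using \<delta> by (simp add: divide_le_eq_1 field_simps)
    finally show "(\<integral>x. (cmod (q (r m) x))\<^sup>2 \<partial>circle_lebesgue) \<le> 4 * \<delta>" .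
    have "(\<integral>x. (cmod (q (r (Suc m)) x - q (r m) x))\<^sup>2 \<partial>circle_lebesgue)
        \<le> (\<integral>x. 2 * (cmod (q (r (Suc m)) x - u x))\<^sup>2 + 2 * (cmod (q (r m) x - u x))\<^sup>2 \<partial>circle_lebesgue)"
    proof (rule integral_mono_AE')
      show "AE x in circle_lebesgue. (cmod (q (r (Suc m)) x - q (r m) x))\<^sup>2
          \<le> 2 * (cmod (q (r (Suc m)) x - u x))\<^sup>2 + 2 * (cmod (q (r m) x - u x))\<^sup>2"
        using norm_add_square_le[of "q (r (Suc m)) x - u x" "u x - q (r m) x" for x]
        by (simp add: norm_minus_commute)
    qed (use int in auto)
    also have "\<dots> = 2 * D (r (Suc m)) + 2 * D (r m)"
      using int by (simp add: D_def)
    also have "\<dots> \<le> 2 * (\<delta> / 8 ^ Suc m) + 2 * (\<delta> / 8 ^ m)"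
      using r(2)[of m] r(2)[of "Suc m"] by simp
    also have "\<dots> \<le> 4 * \<delta> / 8 ^ m"
      using \<delta> by (simp add: field_simps)
    finally show "(\<integral>x. (cmod (q (r (Suc m)) x - q (r m) x))\<^sup>2 \<partial>circle_lebesgue) \<le> 4 * \<delta> / 8 ^ m" .
  qed (use q in auto)
qed

section \<open>Recovery\<close>

context prob_space
begin

lemma std_normal_moments:
  assumes X: "distributed M lborel X std_normal_density"
  shows "random_variable borel X" "integrable M X" "expectation X = 0"
    "integrable M (\<lambda>\<omega>. (X \<omega>)\<^sup>2)" "expectation (\<lambda>\<omega>. (X \<omega>)\<^sup>2) = 1"
proof -
  show "random_variable borel X"
    using distributed_measurable[OF X] by simp
  show "expectation X = 0"
    using X by (rule standard_normal_distributed_expectation)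
  show "integrable M X"
    using integrable_std_normal_moment[of 1] distributed_integrable[OF X, of "\<lambda>x. x"] by simp
  show "integrable M (\<lambda>\<omega>. (X \<omega>)\<^sup>2)"
    using integrable_std_normal_moment[of 2] distributed_integrable[OF X, of "\<lambda>x. x\<^sup>2"] by simp
  show "expectation (\<lambda>\<omega>. (X \<omega>)\<^sup>2) = 1"
    using integral_std_normal_moment_even[of 1] distributed_integral[OF X, of "\<lambda>x. x\<^sup>2"]
    by (simp add: fact_numeral)
qed

lemma std_complex_gaussian_moments:
  assumes Z: "std_complex_gaussian M Z"
  shows "random_variable borel Z" "integrable M Z" "expectation Z = 0"
    "integrable M (\<lambda>\<omega>. (cmod (Z \<omega>))\<^sup>2)" "expectation (\<lambda>\<omega>. (cmod (Z \<omega>))\<^sup>2) = 2"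
proof -
  have D: "distributed M lborel (\<lambda>\<omega>. Re (Z \<omega>)) std_normal_density"
    "distributed M lborel (\<lambda>\<omega>. Im (Z \<omega>)) std_normal_density"
    using Z by (auto simp: std_complex_gaussian_def)
  note re = std_normal_moments[OF D(1)] and im = std_normal_moments[OF D(2)]
  show "random_variable borel Z"
    using re(1) im(1) by (simp add: borel_measurable_complex_iff)
  have Z_eq: "Z = (\<lambda>\<omega>. of_real (Re (Z \<omega>)) + \<i> * of_real (Im (Z \<omega>)))"
    by (simp add: complex_eq_iff fun_eq_iff)
  show "integrable M Z"
    by (subst Z_eq) (use re im in \<open>auto intro!: Bochner_Integration.integrable_add integrable_mult_right\<close>)
  show "expectation Z = 0"
    by (subst Z_eq, subst Bochner_Integration.integral_add) (use re im in auto)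
  show "integrable M (\<lambda>\<omega>. (cmod (Z \<omega>))\<^sup>2)" "expectation (\<lambda>\<omega>. (cmod (Z \<omega>))\<^sup>2) = 2"
    using re im by (simp_all add: cmod_power2)
qed

end

lemma gaussian_noise_orthogonal:
  assumes \<xi>: "gaussian_noise P \<xi>"
  shows "integrable P (\<lambda>\<omega>. \<xi> i \<omega> * cnj (\<xi> j \<omega>))"
    and "(\<integral>\<omega>. \<xi> i \<omega> * cnj (\<xi> j \<omega>) \<partial>P) = (if i = j then of_real 2 else 0)"
proof -
  interpret prob_space P
    using \<xi> by (simp add: gaussian_noise_def)
  have ind: "indep_vars (\<lambda>_. borel) \<xi> UNIV" and g: "\<And>n. std_complex_gaussian P (\<xi> n)"
    using \<xi> by (auto simp: gaussian_noise_def)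
  note m = std_complex_gaussian_moments[OF g]
  have "integrable P (\<lambda>\<omega>. \<xi> i \<omega> * cnj (\<xi> j \<omega>)) \<and>
    (\<integral>\<omega>. \<xi> i \<omega> * cnj (\<xi> j \<omega>) \<partial>P) = (if i = j then of_real 2 else 0)"
  proof (cases "i = j")
    case True
    have "(\<lambda>\<omega>. \<xi> i \<omega> * cnj (\<xi> i \<omega>)) = (\<lambda>\<omega>. of_real ((cmod (\<xi> i \<omega>))\<^sup>2))"
      by (simp only: complex_norm_square)
    then show ?thesis
      using True m(4,5)[of i] by (simp del: of_real_power)
  next
    case False
    \<comment> \<open>Conjugating only the factor with index \<open>j\<close> turns the product into
      one over an independent family, so its expectation is a product of means, all of which are
      0.\<close>
    define Y where "Y k = (if k = i then \<xi> k else (\<lambda>\<omega>. cnj (\<xi> k \<omega>)))" for k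
    have "indep_vars (\<lambda>_. borel) (\<lambda>k \<omega>. (if k = i then (\<lambda>z. z) else cnj) (\<xi> k \<omega>)) {i, j}"
      by (rule indep_vars_compose2[OF indep_vars_subset[OF ind]])
        (auto intro: borel_measurable_continuous_onI continuous_on_cnj continuous_on_id)
    also have "(\<lambda>k \<omega>. (if k = i then (\<lambda>z. z) else cnj) (\<xi> k \<omega>)) = Y"
      by (auto simp: Y_def fun_eq_iff)
    finally have indY: "indep_vars (\<lambda>_. borel) Y {i, j}" .
    have int: "integrable P (Y k)" for k
      using m(2) by (simp add: Y_def)
    show ?thesis
      using indep_vars_lebesgue_integral[OF _ indY int] indep_vars_integrable[OF _ indY int] False m(3)
      by (simp add: Y_def)
  qed
  then show "integrable P (\<lambda>\<omega>. \<xi> i \<omega> * cnj (\<xi> j \<omega>))"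
    and "(\<integral>\<omega>. \<xi> i \<omega> * cnj (\<xi> j \<omega>) \<partial>P) = (if i = j then of_real 2 else 0)"
    by auto
qed

text \<open>Successive polynomials have different frequency sets; padding both coefficient families
  by 0 reduces their difference to one sum over the union. The resulting value depends on the
  orthogonal family only through \<open>a\<close>.\<close>

lemma
  fixes X :: "'i \<Rightarrow> 'a \<Rightarrow> complex"
  assumes X: "\<And>i j. integrable M (\<lambda>x. X i x * cnj (X j x))"
    "\<And>i j. (\<integral>x. X i x * cnj (X j x) \<partial>M) = (if i = j then of_real a else 0)"
    and J: "finite J" "finite K"
  shows integrable_norm_diff_orthogonal:
      "integrable M (\<lambda>x. (cmod ((\<Sum>j\<in>J. c j * X j x) - (\<Sum>j\<in>K. d j * X j x)))\<^sup>2)"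
    and integral_norm_diff_orthogonal:
      "(\<integral>x. (cmod ((\<Sum>j\<in>J. c j * X j x) - (\<Sum>j\<in>K. d j * X j x)))\<^sup>2 \<partial>M)
        = a * (\<Sum>j\<in>J \<union> K. (cmod ((if j \<in> J then c j else 0) - (if j \<in> K then d j else 0)))\<^sup>2)"
proof -
  have "(\<Sum>j\<in>J. c j * X j x) - (\<Sum>j\<in>K. d j * X j x)
      = (\<Sum>j\<in>J \<union> K. ((if j \<in> J then c j else 0) - (if j \<in> K then d j else 0)) * X j x)" for x
  proof -
    have "(\<Sum>j\<in>J. c j * X j x) = (\<Sum>j\<in>J \<union> K. (if j \<in> J then c j else 0) * X j x)"
      by (rule sum.mono_neutral_cong_left) (use J in auto)
    moreover have "(\<Sum>j\<in>K. d j * X j x) = (\<Sum>j\<in>J \<union> K. (if j \<in> K then d j else 0) * X j x)"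
      by (rule sum.mono_neutral_cong_left) (use J in auto)
    ultimately show ?thesis
      by (simp add: left_diff_distrib sum_subtractf)
  qed
  then show "integrable M (\<lambda>x. (cmod ((\<Sum>j\<in>J. c j * X j x) - (\<Sum>j\<in>K. d j * X j x)))\<^sup>2)"
    and "(\<integral>x. (cmod ((\<Sum>j\<in>J. c j * X j x) - (\<Sum>j\<in>K. d j * X j x)))\<^sup>2 \<partial>M)
        = a * (\<Sum>j\<in>J \<union> K. (cmod ((if j \<in> J then c j else 0) - (if j \<in> K then d j else 0)))\<^sup>2)"
    using integrable_norm_sum_orthogonal[OF X] integral_norm_sum_orthogonal[OF X] J by simp_all
qed

text \<open>The factor 2 is the second absolute moment of a standard complex Gaussian.\<close>

lemma noise_isometry:
  assumes \<xi>: "gaussian_noise P \<xi>" and J: "finite J" "finite K"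
  shows "(\<integral>\<^sup>+\<omega>. ennreal ((cmod ((\<Sum>j\<in>J. c j * \<xi> (n - j) \<omega>) - (\<Sum>j\<in>K. d j * \<xi> (n - j) \<omega>)))\<^sup>2) \<partial>P)
    = ennreal (2 * (\<integral>x. (cmod ((\<Sum>j\<in>J. c j * circle_char j x) - (\<Sum>j\<in>K. d j * circle_char j x)))\<^sup>2 \<partial>circle_lebesgue))"
proof -
  \<comment> \<open>The reindexing of the noise by \<open>n - j\<close> is injective, so the
    reindexed family is still orthogonal.\<close>
  note orth = gaussian_noise_orthogonal[OF \<xi>, of "n - i" "n - j" for i j, simplified]
  note * = integrable_norm_diff_orthogonal[of P "\<lambda>j. \<xi> (n - j)" 2]
    integral_norm_diff_orthogonal[of P "\<lambda>j. \<xi> (n - j)" 2]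
  have circle: "integrable circle_lebesgue (\<lambda>x. circle_char i x * cnj (circle_char j x))"
    "(\<integral>x. circle_char i x * cnj (circle_char j x) \<partial>circle_lebesgue) = (if i = j then of_real 1 else 0)" for i j
    using circle_char_orthonormal by simp_all
  show ?thesis
    by (subst nn_integral_eq_integral)
      (simp_all add: * orth J integral_norm_diff_orthogonal[OF circle J])
qed

section \<open>Almost sure convergence from second-moment bounds\<close>

text \<open>By monotone convergence the integral of the sum is the sum of the integrals, hence
  finite, and a nonnegative function with finite integral is finite almost everywhere.\<close>

lemma AE_summable:
  fixes h :: "nat \<Rightarrow> 'a \<Rightarrow> real"
  assumes h [measurable]: "\<And>m. h m \<in> borel_measurable M" and nonneg: "\<And>m x. h m x \<ge> 0"
    and le: "\<And>m. (\<integral>\<^sup>+x. ennreal (h m x) \<partial>M) \<le> ennreal (b m)" and b: "summable b" "\<And>m. b m \<ge> 0"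
  shows "AE x in M. summable (\<lambda>m. h m x)"
proof -
  have "(\<integral>\<^sup>+x. (\<Sum>m. ennreal (h m x)) \<partial>M) = (\<Sum>m. \<integral>\<^sup>+x. ennreal (h m x) \<partial>M)"
    by (rule nn_integral_suminf) auto
  also have "\<dots> \<le> (\<Sum>m. ennreal (b m))"
    by (intro suminf_le le) auto
  also have "\<dots> = ennreal (\<Sum>m. b m)"
    using b by (intro suminf_ennreal2)
  finally have "(\<integral>\<^sup>+x. (\<Sum>m. ennreal (h m x)) \<partial>M) \<noteq> \<infinity>"
    by (auto simp: top_unique)
  then have "AE x in M. (\<Sum>m. ennreal (h m x)) \<noteq> \<infinity>"
    by (intro nn_integral_PInf_AE) auto
  then show ?thesis
    by eventually_elim (use nonneg in \<open>auto intro: summable_suminf_not_top\<close>)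
qed

text \<open>Summability of the increments \<open>d\<^sub>m\<close> follows from \<open>\<bar>d\<^sub>m\<bar> \<le> 2\<^sup>-\<^sup>m + 2\<^sup>m \<bar>d\<^sub>m\<bar>\<^sup>2\<close>.\<close>

lemma AE_convergent:
  fixes f :: "nat \<Rightarrow> 'a \<Rightarrow> complex"
  assumes f [measurable]: "\<And>m. f m \<in> borel_measurable M" and C: "C \<ge> 0"
    and le: "\<And>m. (\<integral>\<^sup>+x. ennreal ((cmod (f (Suc m) x - f m x))\<^sup>2) \<partial>M) \<le> ennreal (C / 8 ^ m)"
  shows "AE x in M. convergent (\<lambda>m. f m x)"
proof -
  have "AE x in M. summable (\<lambda>m. 2 ^ m * (cmod (f (Suc m) x - f m x))\<^sup>2)"
  proof (rule AE_summable)
    fix m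
    have "(\<integral>\<^sup>+x. ennreal (2 ^ m * (cmod (f (Suc m) x - f m x))\<^sup>2) \<partial>M)
        = 2 ^ m * (\<integral>\<^sup>+x. ennreal ((cmod (f (Suc m) x - f m x))\<^sup>2) \<partial>M)"
      by (subst nn_integral_cmult[symmetric]) (auto simp: ennreal_mult ennreal_power[symmetric])
    also have "\<dots> \<le> 2 ^ m * ennreal (C / 8 ^ m)"
      by (intro mult_left_mono le) auto
    also have "\<dots> = ennreal (2 ^ m) * ennreal (C / 8 ^ m)"
      by (simp add: ennreal_power[symmetric])
    also have "\<dots> = ennreal (C * (1/4) ^ m)"
    proof -
      \<comment> \<open>The weight \<open>2 ^ m\<close> uses up part of the rate
        \<open>8 ^ m\<close> and leaves a convergent geometric series of ratio 1/4.\<close>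
      have "(8::real) ^ m = 2 ^ m * 4 ^ m"
        by (simp add: power_mult_distrib[symmetric])
      then show ?thesis
        using C by (simp add: ennreal_mult[symmetric] power_divide)
    qed
    finally show "(\<integral>\<^sup>+x. ennreal (2 ^ m * (cmod (f (Suc m) x - f m x))\<^sup>2) \<partial>M) \<le> ennreal (C * (1/4) ^ m)" .
  qed (use C in \<open>auto intro!: summable_mult summable_geometric\<close>)
  then show ?thesis
  proof eventually_elim
    case (elim x)
    define d where "d m = f (Suc m) x - f m x" for m
    have d_le: "cmod (d m) \<le> (1/2) ^ m + 2 ^ m * (cmod (d m))\<^sup>2" for m
    proof -
      have "(2 ^ m * cmod (d m) - 1)\<^sup>2 \<ge> 0"
        by simp
      then have "2 * (2 ^ m * cmod (d m)) \<le> 1 + 2 ^ m * (2 ^ m * (cmod (d m))\<^sup>2)"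
        by (simp add: power2_eq_square algebra_simps)
      moreover have "0 \<le> 2 ^ m * cmod (d m)"
        by simp
      ultimately have "2 ^ m * cmod (d m) \<le> 1 + 2 ^ m * (2 ^ m * (cmod (d m))\<^sup>2)"
        by linarith
      also have "\<dots> = 2 ^ m * ((1/2) ^ m + 2 ^ m * (cmod (d m))\<^sup>2)"
        by (simp add: distrib_left power_mult_distrib[symmetric])
      finally show ?thesis
        by (simp only: mult_le_cancel_left_pos zero_less_power zero_less_numeral)
    qed
    have "summable (\<lambda>m. (1/2) ^ m + 2 ^ m * (cmod (d m))\<^sup>2)"
      using elim by (intro summable_add summable_geometric) (auto simp: d_def)
    then have "summable d"
      by (rule summable_comparison_test'[of _ 0]) (rule d_le)
    then have "(\<lambda>n. f 0 x + (\<Sum>m<n. d m)) \<longlonglongrightarrow> f 0 x + suminf d"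
      by (intro tendsto_add tendsto_const summable_LIMSEQ)
    moreover have "f 0 x + (\<Sum>m<n. d m) = f n x" for n
      unfolding d_def sum_lessThan_telescope[of "\<lambda>m. f m x"] by simp
    ultimately show ?case
      by (auto intro: convergentI)
  qed
qed

lemma AE_tendsto_0:
  fixes g :: "nat \<Rightarrow> 'a \<Rightarrow> complex"
  assumes g [measurable]: "\<And>k. g k \<in> borel_measurable M"
    and le: "\<And>k. (\<integral>\<^sup>+x. ennreal ((cmod (g k x))\<^sup>2) \<partial>M) \<le> ennreal (b k)" and b: "summable b" "\<And>k. b k \<ge> 0"
  shows "AE x in M. (\<lambda>k. g k x) \<longlonglongrightarrow> 0"
proof -
  have "AE x in M. summable (\<lambda>k. (cmod (g k x))\<^sup>2)"
    by (rule AE_summable[OF _ _ le b]) auto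
  then show ?thesis
  proof eventually_elim
    case (elim x)
    then have "(\<lambda>k. sqrt ((cmod (g k x))\<^sup>2)) \<longlonglongrightarrow> sqrt 0"
      by (intro tendsto_real_sqrt summable_LIMSEQ_zero)
    then show ?case
      by (simp add: tendsto_norm_zero_iff)
  qed
qed

text \<open>Fatou's lemma: where the sequence converges, the squared modulus of the limit equals the
  lower limit of the squared moduli. The arbitrary value of \<open>lim\<close> at divergent points
  affects only a null set.\<close>

lemma nn_integral_lim_le:
  fixes f :: "nat \<Rightarrow> 'a \<Rightarrow> complex"
  assumes f [measurable]: "\<And>m. f m \<in> borel_measurable M"
    and conv: "AE x in M. convergent (\<lambda>m. f m x)"
    and le: "\<And>m. (\<integral>\<^sup>+x. ennreal ((cmod (f m x))\<^sup>2) \<partial>M) \<le> b"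
  shows "(\<integral>\<^sup>+x. ennreal ((cmod (lim (\<lambda>m. f m x)))\<^sup>2) \<partial>M) \<le> b"
proof -
  have "(\<integral>\<^sup>+x. ennreal ((cmod (lim (\<lambda>m. f m x)))\<^sup>2) \<partial>M)
      = (\<integral>\<^sup>+x. liminf (\<lambda>m. ennreal ((cmod (f m x))\<^sup>2)) \<partial>M)"
  proof (rule nn_integral_cong_AE)
    show "AE x in M. ennreal ((cmod (lim (\<lambda>m. f m x)))\<^sup>2) = liminf (\<lambda>m. ennreal ((cmod (f m x))\<^sup>2))"
      using conv
    proof eventually_elim
      case (elim x)
      then have "(\<lambda>m. f m x) \<longlonglongrightarrow> lim (\<lambda>m. f m x)"
        by (simp add: convergent_LIMSEQ_iff)
      then have "(\<lambda>m. ennreal ((cmod (f m x))\<^sup>2)) \<longlonglongrightarrow> ennreal ((cmod (lim (\<lambda>m. f m x)))\<^sup>2)"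
        by (intro tendsto_intros)
      then show ?case
        by (intro lim_imp_Liminf[symmetric]) auto
    qed
  qed
  also have "\<dots> \<le> liminf (\<lambda>m. \<integral>\<^sup>+x. ennreal ((cmod (f m x))\<^sup>2) \<partial>M)"
    by (rule nn_integral_liminf) auto
  also have "\<dots> \<le> b"
    using le by (intro Liminf_le) auto
  finally show ?thesis .
qed

section \<open>The recovery map\<close>

text \<open>Since \<open>- (n - j) = j + (- n)\<close>, convolving the Fourier coefficients with
  \<open>c\<close> amounts to multiplying the integrand by the polynomial with coefficients
  \<open>c\<close>.\<close>

lemma fourier_trig_sum:
  assumes \<mu>: "complex_measure borel \<mu>"
  shows "(\<Sum>j\<in>J. c j * fourier \<mu> (n - j))
    = complex_integral borel \<mu> (\<lambda>x. (\<Sum>j\<in>J. c j * circle_char j x) * circle_char (- n) x)"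
proof -
  have "(\<Sum>j\<in>J. c j * fourier \<mu> (n - j))
      = complex_integral borel \<mu> (\<lambda>x. \<Sum>j\<in>J. c j * circle_char (- (n - j)) x)"
    unfolding fourier_def by (rule complex_integral_sum[OF \<mu>, where K = 1, symmetric]) auto
  also have "(\<lambda>x. \<Sum>j\<in>J. c j * circle_char (- (n - j)) x)
      = (\<lambda>x. (\<Sum>j\<in>J. c j * circle_char j x) * circle_char (- n) x)"
    by (simp add: sum_distrib_right mult.assoc circle_char_add[symmetric])
  finally show ?thesis .
qed

lemma null_set_admits_recovery:
  assumes \<xi>: "gaussian_noise P \<xi>"
    and E: "E \<in> sets borel" "emeasure circle_lebesgue E = 0"
  shows "admits_recovery P \<xi> (fourier_transforms E)"
proof -
  \<comment> \<open>Summability in \<open>k\<close> is what makes the limiting noise vanish almost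
    surely in \<open>AE_tendsto_0\<close>.\<close>
  define \<delta> :: "nat \<Rightarrow> real" where "\<delta> k = (1/4) ^ k" for k
  have \<delta>: "\<delta> k > 0" for k
    by (simp add: \<delta>_def)
  define Q where "Q k p \<longleftrightarrow> (\<forall>m::nat. trig_poly (p m)) \<and> (\<forall>m x. cmod (p m x) \<le> 2) \<and>
      (\<forall>x\<in>E. (\<lambda>m. p m x) \<longlonglongrightarrow> 1) \<and>
      (\<forall>m. (\<integral>x. (cmod (p m x))\<^sup>2 \<partial>circle_lebesgue) \<le> 4 * \<delta> k) \<and>
      (\<forall>m. (\<integral>x. (cmod (p (Suc m) x - p m x))\<^sup>2 \<partial>circle_lebesgue) \<le> 4 * \<delta> k / 8 ^ m)" for k p
  have "\<exists>p. Q k p" for k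
  proof (rule trig_poly_approximants[OF E \<delta>[of k]], rule exI)
    fix p
    assume "\<And>m::nat. trig_poly (p m)" "\<And>m x. cmod (p m x) \<le> 2" "\<And>x. x \<in> E \<Longrightarrow> (\<lambda>m. p m x) \<longlonglongrightarrow> 1"
      "\<And>m. (\<integral>x. (cmod (p m x))\<^sup>2 \<partial>circle_lebesgue) \<le> 4 * \<delta> k"
      "\<And>m. (\<integral>x. (cmod (p (Suc m) x - p m x))\<^sup>2 \<partial>circle_lebesgue) \<le> 4 * \<delta> k / 8 ^ m"
    then show "Q k p"
      by (simp add: Q_def)
  qed
  then obtain p where "\<And>k. Q k (p k)"
    by metis
  then have p: "\<And>k m::nat. trig_poly (p k m)" "\<And>k m x. cmod (p k m x) \<le> 2"
    "\<And>k x. x \<in> E \<Longrightarrow> (\<lambda>m. p k m x) \<longlonglongrightarrow> 1"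
    "\<And>k m. (\<integral>x. (cmod (p k m x))\<^sup>2 \<partial>circle_lebesgue) \<le> 4 * \<delta> k"
    "\<And>k m. (\<integral>x. (cmod (p k (Suc m) x - p k m x))\<^sup>2 \<partial>circle_lebesgue) \<le> 4 * \<delta> k / 8 ^ m"
    by (simp_all add: Q_def)
  have "\<exists>J c. finite J \<and> p k m = (\<lambda>x. \<Sum>j\<in>J. c j * circle_char j x)" for k m
    using p(1) unfolding trig_poly_def .
  then obtain J c where J: "\<And>k m. finite (J k m)"
    and p_eq: "\<And>k m. p k m = (\<lambda>x. \<Sum>j\<in>J k m. c k m j * circle_char j x)"
    by metis
  \<comment> \<open>The coefficients come from \<open>E\<close> alone, so one map serves every
    measure carried by \<open>E\<close>. \<open>lim\<close> is total, so \<open>T\<close> is defined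
    everywhere, and its values at divergent sequences only have to be measurable.\<close>
  define T :: "(int \<Rightarrow> complex) \<Rightarrow> int \<Rightarrow> complex"
    where "T y n = lim (\<lambda>k. lim (\<lambda>m. \<Sum>j\<in>J k m. c k m j * y (n - j)))" for y n
  define N where "N n k m \<omega> = (\<Sum>j\<in>J k m. c k m j * \<xi> (n - j) \<omega>)" for n k m \<omega>
  interpret P: prob_space P
    using \<xi> by (simp add: gaussian_noise_def)
  have [measurable]: "\<xi> n \<in> borel_measurable P" for n
    using \<xi> P.std_complex_gaussian_moments(1) by (simp add: gaussian_noise_def)
  have N_meas [measurable]: "N n k m \<in> borel_measurable P" for n k m
    unfolding N_def by measurable
  have N_diff: "(\<integral>\<^sup>+\<omega>. ennreal ((cmod (N n k (Suc m) \<omega> - N n k m \<omega>))\<^sup>2) \<partial>P) \<le> ennreal (8 * \<delta> k / 8 ^ m)" for n k m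
    unfolding N_def noise_isometry[OF \<xi> J J]
    using p(5)[of k m] by (intro ennreal_leI) (simp add: p_eq)
  \<comment> \<open>The isometry is used with the empty sum as second combination; 8 is the factor 2
    of the isometry times the constant 4 of the polynomials.\<close>
  have N_le: "(\<integral>\<^sup>+\<omega>. ennreal ((cmod (N n k m \<omega>))\<^sup>2) \<partial>P) \<le> ennreal (8 * \<delta> k)" for n k m
    using noise_isometry[OF \<xi> J[of k m] finite.emptyI, of "c k m" n] p(4)[of k m]
    by (simp add: N_def p_eq ennreal_leI)
  have N_conv: "AE \<omega> in P. convergent (\<lambda>m. N n k m \<omega>)" for n k
    by (rule AE_convergent[OF N_meas _ N_diff]) (simp add: \<delta>_def)
  have N_lim: "AE \<omega> in P. (\<lambda>k. lim (\<lambda>m. N n k m \<omega>)) \<longlonglongrightarrow> 0" for n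
  proof (rule AE_tendsto_0)
    show "(\<integral>\<^sup>+\<omega>. ennreal ((cmod (lim (\<lambda>m. N n k m \<omega>)))\<^sup>2) \<partial>P) \<le> ennreal (8 * \<delta> k)" for k
      by (rule nn_integral_lim_le[OF N_meas N_conv N_le])
    show "summable (\<lambda>k. 8 * \<delta> k)"
      unfolding \<delta>_def by (intro summable_mult summable_geometric) simp
  qed (auto simp: \<delta>_def)
  have "AE \<omega> in P. T (\<lambda>n. x n + \<xi> n \<omega>) = x" if xE: "x \<in> fourier_transforms E" for x
  proof -
    obtain \<mu> where \<mu>: "complex_measure borel \<mu>" "carried_by borel \<mu> E" and x: "x = fourier \<mu>"
      using xE unfolding fourier_transforms_def by blast
    have signal: "(\<lambda>m. \<Sum>j\<in>J k m. c k m j * x (n - j)) \<longlonglongrightarrow> x n" for n k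
    proof -
      have "(\<lambda>m. complex_integral borel \<mu> (\<lambda>t. p k m t * circle_char (- n) t))
          \<longlonglongrightarrow> complex_integral borel \<mu> (circle_char (- n))"
      proof (rule complex_integral_dominated_convergence[OF \<mu> E(1)])
        show "cmod (p k m t * circle_char (- n) t) \<le> 2" for m t
          using p(2) by (simp add: norm_mult)
        show "(\<lambda>m. p k m t * circle_char (- n) t) \<longlonglongrightarrow> circle_char (- n) t" if "t \<in> E" for t
          using tendsto_mult[OF p(3)[OF that] tendsto_const[of "circle_char (- n) t"]] by simp
        show "(\<lambda>t. p k m t * circle_char (- n) t) \<in> borel_measurable borel" for m
          by (intro borel_measurable_times trig_poly_measurable p(1) measurable_circle_char)
      qed simp
      then show ?thesis
        unfolding x p_eq fourier_trig_sum[OF \<mu>(1)] by (simp add: fourier_def)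
    qed
    \<comment> \<open>Only countably many exceptional null sets occur, so one almost sure event
      handles all coordinates and all \<open>k\<close> together.\<close>
    have "AE \<omega> in P. (\<forall>n k. convergent (\<lambda>m. N n k m \<omega>)) \<and> (\<forall>n. (\<lambda>k. lim (\<lambda>m. N n k m \<omega>)) \<longlonglongrightarrow> 0)"
      using N_conv N_lim by (simp add: AE_all_countable)
    then show ?thesis
    proof eventually_elim
      case (elim \<omega>)
      have "lim (\<lambda>m. \<Sum>j\<in>J k m. c k m j * (x (n - j) + \<xi> (n - j) \<omega>)) = x n + lim (\<lambda>m. N n k m \<omega>)" for n k
      proof (rule limI)
        have "(\<lambda>m. (\<Sum>j\<in>J k m. c k m j * x (n - j)) + N n k m \<omega>) \<longlonglongrightarrow> x n + lim (\<lambda>m. N n k m \<omega>)"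
          using elim by (intro tendsto_add signal) (simp add: convergent_LIMSEQ_iff)
        then show "(\<lambda>m. \<Sum>j\<in>J k m. c k m j * (x (n - j) + \<xi> (n - j) \<omega>)) \<longlonglongrightarrow> x n + lim (\<lambda>m. N n k m \<omega>)"
          by (simp add: N_def distrib_left sum.distrib)
      qed
      moreover have "lim (\<lambda>k. x n + lim (\<lambda>m. N n k m \<omega>)) = x n" for n
        using elim tendsto_add[OF tendsto_const[of "x n"], of "\<lambda>k. lim (\<lambda>m. N n k m \<omega>)" 0]
        by (intro limI) simp
      ultimately show ?case
        by (simp add: T_def fun_eq_iff)
    qed
  qed
  moreover have "T \<in> borel \<rightarrow>\<^sub>M borel"
    unfolding T_def[abs_def]
    by (intro measurable_coordinatewise_then_product borel_measurable_lim_metric borel_measurable_sum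
        borel_measurable_times borel_measurable_const measurable_product_coordinates)
  ultimately show ?thesis
    unfolding admits_recovery_def by blast
qed

section \<open>Shifts of the noise\<close>

text \<open>The Cameron--Martin density: for a standard complex Gaussian \<open>Z\<close>, the law
  of \<open>a + Z\<close> has density \<open>tilt a\<close> with respect to the law of
  \<open>Z\<close>.\<close>

definition tilt :: "complex \<Rightarrow> complex \<Rightarrow> real"
  where "tilt a z = exp (Re a * Re z + Im a * Im z - (cmod a)\<^sup>2 / 2)"

lemma tilt_nonneg: "0 \<le> tilt a z"
  by (simp add: tilt_def)

lemma measurable_tilt [measurable]: "tilt a \<in> borel_measurable borel"
  unfolding tilt_def by measurable

text \<open>The square is a constant times the density for the doubled shift. As a density has mean
  1, the constant is the second moment.\<close>

lemma tilt_square: "(tilt a z)\<^sup>2 = tilt (2 * a) z * exp ((cmod a)\<^sup>2)"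
  by (simp add: tilt_def power2_eq_square exp_add[symmetric] norm_mult)

lemma std_normal_density_shift:
  "std_normal_density (x - a) = std_normal_density x * exp (a * x - a\<^sup>2 / 2)"
proof -
  have "- (x - a)\<^sup>2 / 2 = - x\<^sup>2 / 2 + (a * x - a\<^sup>2 / 2)"
    by (simp add: power2_eq_square field_simps)
  then show ?thesis
    unfolding std_normal_density_def by (simp only: exp_add mult.assoc)
qed

lemma emeasure_distr_eq_nn_integral:
  assumes [measurable]: "f \<in> M \<rightarrow>\<^sub>M N" "A \<in> sets N"
  shows "emeasure (distr M N f) A = (\<integral>\<^sup>+x. indicator A (f x) \<partial>M)"
proof -
  have "emeasure (distr M N f) A = (\<integral>\<^sup>+y. indicator A y \<partial>distr M N f)"
    by (rule nn_integral_indicator[symmetric]) simp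
  also have "\<dots> = (\<integral>\<^sup>+x. indicator A (f x) \<partial>M)"
    by (rule nn_integral_distr) measurable
  finally show ?thesis .
qed

text \<open>Translation invariance of Lebesgue measure on the plane moves the shift from
  \<open>h\<close> to the joint density of the real and imaginary parts, and the ratio of the
  shifted to the original density is \<open>tilt a\<close>.\<close>

lemma (in prob_space) gaussian_shift:
  fixes h :: "complex \<Rightarrow> ennreal"
  assumes Z: "std_complex_gaussian M Z" and h [measurable]: "h \<in> borel_measurable borel"
  shows "(\<integral>\<^sup>+\<omega>. h (a + Z \<omega>) \<partial>M) = (\<integral>\<^sup>+\<omega>. h (Z \<omega>) * ennreal (tilt a (Z \<omega>)) \<partial>M)"
proof -
  define G :: "real \<times> real \<Rightarrow> ennreal"
    where "G v = ennreal (std_normal_density (fst v)) * ennreal (std_normal_density (snd v))" for v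
  define c where "c = (Re a, Im a)"
  have [measurable]: "G \<in> borel_measurable borel"
    unfolding G_def borel_prod[symmetric] by measurable
  have C [measurable]: "(\<lambda>v. Complex (fst v) (snd v)) \<in> borel_measurable (borel :: (real \<times> real) measure)"
    by (simp add: borel_measurable_complex_iff borel_prod[symmetric])
  have "distributed M (lborel \<Otimes>\<^sub>M lborel) (\<lambda>\<omega>. (Re (Z \<omega>), Im (Z \<omega>)))
      (\<lambda>(x, y). ennreal (std_normal_density x) * ennreal (std_normal_density y))"
    using Z by (intro distributed_joint_indep lborel.sigma_finite_measure_axioms)
      (auto simp: std_complex_gaussian_def indep_var_eq)
  then have D: "distributed M lborel (\<lambda>\<omega>. (Re (Z \<omega>), Im (Z \<omega>))) G"
    by (simp add: lborel_prod G_def[abs_def] case_prod_unfold)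
  have D_int: "(\<integral>\<^sup>+\<omega>. f (Re (Z \<omega>), Im (Z \<omega>)) \<partial>M) = (\<integral>\<^sup>+v. G v * f v \<partial>lborel)"
    if "f \<in> borel_measurable borel" for f
    using distributed_nn_integral[OF D, of f] that by simp
  have [measurable]: "(\<lambda>v. Complex (fst (c + v)) (snd (c + v))) \<in> borel_measurable (borel :: (real \<times> real) measure)"
    by (rule measurable_compose[OF _ C]) measurable
  have shift_meas: "(\<lambda>v. h (Complex (fst (c + v)) (snd (c + v)))) \<in> borel_measurable borel"
    by measurable
  have G_shift: "G (v - c) = G v * ennreal (tilt a (Complex (fst v) (snd v)))" for v
  proof -
    have "exp (Re a * fst v - (Re a)\<^sup>2 / 2) * exp (Im a * snd v - (Im a)\<^sup>2 / 2)
        = tilt a (Complex (fst v) (snd v))"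
      unfolding tilt_def exp_add[symmetric] cmod_power2 by (simp add: add_divide_distrib)
    note this [symmetric]
    then have "std_normal_density (fst v - Re a) * std_normal_density (snd v - Im a)
        = std_normal_density (fst v) * std_normal_density (snd v) * tilt a (Complex (fst v) (snd v))"
      by (simp only: std_normal_density_shift mult_ac)
    then show ?thesis
      by (simp add: G_def c_def ennreal_mult[symmetric] tilt_nonneg)
  qed
  have "(\<integral>\<^sup>+\<omega>. h (a + Z \<omega>) \<partial>M) = (\<integral>\<^sup>+\<omega>. h (Complex (Re a + Re (Z \<omega>)) (Im a + Im (Z \<omega>))) \<partial>M)"
    by (intro nn_integral_cong arg_cong[of _ _ h]) (simp add: complex_eq_iff)
  also have "\<dots> = (\<integral>\<^sup>+v. G v * h (Complex (fst (c + v)) (snd (c + v))) \<partial>lborel)"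
    using D_int[OF shift_meas] by (simp add: c_def)
  \<comment> \<open>The integrand is rewritten as a function of \<open>c + v\<close> alone, ready
    for the change of variables.\<close>
  also have "\<dots> = (\<integral>\<^sup>+v. G (c + v - c) * h (Complex (fst (c + v)) (snd (c + v))) \<partial>lborel)"
    by simp
  also have "\<dots> = (\<integral>\<^sup>+v. G (v - c) * h (Complex (fst v) (snd v)) \<partial>distr lborel borel ((+) c))"
    by (subst nn_integral_distr) simp_all
  also have "\<dots> = (\<integral>\<^sup>+v. G v * (h (Complex (fst v) (snd v)) * ennreal (tilt a (Complex (fst v) (snd v)))) \<partial>lborel)"
    unfolding lborel_distr_plus by (simp add: G_shift mult_ac)
  also have "\<dots> = (\<integral>\<^sup>+\<omega>. h (Z \<omega>) * ennreal (tilt a (Z \<omega>)) \<partial>M)"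
    by (subst D_int[symmetric]) simp_all
  finally show ?thesis .
qed

lemma (in prob_space) nn_integral_tilt_square:
  assumes Z: "std_complex_gaussian M Z"
  shows "(\<integral>\<^sup>+\<omega>. ennreal ((tilt a (Z \<omega>))\<^sup>2) \<partial>M) = ennreal (exp ((cmod a)\<^sup>2))"
proof -
  have [measurable]: "Z \<in> borel_measurable M"
    by (rule std_complex_gaussian_moments(1)[OF Z])
  \<comment> \<open>The shift formula for the constant function 1 says that the density has total
    mass 1.\<close>
  have "(\<integral>\<^sup>+\<omega>. ennreal (tilt (2 * a) (Z \<omega>)) \<partial>M) = 1"
    using gaussian_shift[OF Z, of "\<lambda>_. 1" "2 * a"] by (simp add: emeasure_space_1)
  then show ?thesis
    by (simp add: tilt_square ennreal_mult tilt_nonneg nn_integral_multc)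
qed

section \<open>Shifting finitely many coordinates\<close>

text \<open>Independence splits the integral of a product into one-coordinate integrals, where
  \<open>gaussian_shift\<close> applies. Products of indicators give boxes, which determine the law
  on the coordinates in \<open>J\<close>.\<close>

lemma gaussian_noise_shift:
  fixes h :: "int \<Rightarrow> complex \<Rightarrow> ennreal"
  assumes \<xi>: "gaussian_noise P \<xi>" and J: "finite J" and h [measurable]: "\<And>j. h j \<in> borel_measurable borel"
  shows "(\<integral>\<^sup>+\<omega>. (\<Prod>j\<in>J. h j (x j + \<xi> j \<omega>)) \<partial>P)
    = (\<integral>\<^sup>+\<omega>. (\<Prod>j\<in>J. h j (\<xi> j \<omega>)) * (\<Prod>j\<in>J. ennreal (tilt (x j) (\<xi> j \<omega>))) \<partial>P)"
proof -
  interpret prob_space P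
    using \<xi> by (simp add: gaussian_noise_def)
  have g: "std_complex_gaussian P (\<xi> j)" for j
    using \<xi> by (simp add: gaussian_noise_def)
  have prod: "(\<integral>\<^sup>+\<omega>. (\<Prod>j\<in>J. f j (\<xi> j \<omega>)) \<partial>P) = (\<Prod>j\<in>J. \<integral>\<^sup>+\<omega>. f j (\<xi> j \<omega>) \<partial>P)"
    if "\<And>j. f j \<in> borel_measurable borel" for f :: "int \<Rightarrow> complex \<Rightarrow> ennreal"
  proof (rule indep_vars_nn_integral[OF J])
    have "indep_vars (\<lambda>_. borel) \<xi> J"
      using \<xi> indep_vars_subset by (force simp: gaussian_noise_def)
    then show "indep_vars (\<lambda>_. borel) (\<lambda>j \<omega>. f j (\<xi> j \<omega>)) J"
      by (rule indep_vars_compose2) (rule that)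
  qed simp
  have "(\<integral>\<^sup>+\<omega>. (\<Prod>j\<in>J. h j (x j + \<xi> j \<omega>)) \<partial>P) = (\<Prod>j\<in>J. \<integral>\<^sup>+\<omega>. h j (x j + \<xi> j \<omega>) \<partial>P)"
    by (rule prod[of "\<lambda>j z. h j (x j + z)"]) measurable
  also have "\<dots> = (\<Prod>j\<in>J. \<integral>\<^sup>+\<omega>. h j (\<xi> j \<omega>) * ennreal (tilt (x j) (\<xi> j \<omega>)) \<partial>P)"
    by (intro prod.cong gaussian_shift g) auto
  also have "\<dots> = (\<integral>\<^sup>+\<omega>. (\<Prod>j\<in>J. h j (\<xi> j \<omega>) * ennreal (tilt (x j) (\<xi> j \<omega>))) \<partial>P)"
    by (rule prod[of "\<lambda>j z. h j z * ennreal (tilt (x j) z)", symmetric]) measurable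
  finally show ?thesis
    by (simp add: prod.distrib)
qed

lemma measurable_noise:
  assumes \<xi>: "gaussian_noise P \<xi>"
  shows "\<xi> n \<in> borel_measurable P" "(\<lambda>\<omega> n. \<xi> n \<omega>) \<in> P \<rightarrow>\<^sub>M borel" "(\<lambda>\<omega> n. x n + \<xi> n \<omega>) \<in> P \<rightarrow>\<^sub>M borel"
proof -
  have [measurable]: "\<xi> n \<in> borel_measurable P" for n
    using \<xi> prob_space.std_complex_gaussian_moments(1) by (auto simp: gaussian_noise_def)
  show "\<xi> n \<in> borel_measurable P"
    by measurable
  show "(\<lambda>\<omega> n. \<xi> n \<omega>) \<in> P \<rightarrow>\<^sub>M borel" "(\<lambda>\<omega> n. x n + \<xi> n \<omega>) \<in> P \<rightarrow>\<^sub>M borel"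
    by (rule measurable_coordinatewise_then_product, measurable)+
qed

text \<open>The shifted law and the reweighted law on the coordinates in \<open>J\<close> agree on
  boxes, hence coincide by uniqueness on a generating pi-system. The hypothesis on \<open>A\<close>
  lets it be read as a set in this finite product.\<close>

lemma gaussian_noise_shift_cylinder:
  assumes \<xi>: "gaussian_noise P \<xi>" and J: "finite J" and A: "A \<in> sets borel"
    and dep: "\<And>f g :: int \<Rightarrow> complex. (\<And>j. j \<in> J \<Longrightarrow> f j = g j) \<Longrightarrow> f \<in> A \<longleftrightarrow> g \<in> A"
  shows "emeasure P {\<omega> \<in> space P. (\<lambda>n. x n + \<xi> n \<omega>) \<in> A}
    = (\<integral>\<^sup>+\<omega>. indicator A (\<lambda>n. \<xi> n \<omega>) * (\<Prod>j\<in>J. ennreal (tilt (x j) (\<xi> j \<omega>))) \<partial>P)"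
proof -
  interpret prob_space P
    using \<xi> by (simp add: gaussian_noise_def)
  note [measurable] = measurable_noise[OF \<xi>]
  define D where "D = density P (\<lambda>\<omega>. \<Prod>j\<in>J. ennreal (tilt (x j) (\<xi> j \<omega>)))"
  define Q1 where "Q1 = distr P (PiM J (\<lambda>_. borel)) (\<lambda>\<omega>. \<lambda>j\<in>J. x j + \<xi> j \<omega>)"
  define Q2 where "Q2 = distr D (PiM J (\<lambda>_. borel)) (\<lambda>\<omega>. \<lambda>j\<in>J. \<xi> j \<omega>)"
  have X1 [measurable]: "(\<lambda>\<omega>. \<lambda>j\<in>J. x j + \<xi> j \<omega>) \<in> P \<rightarrow>\<^sub>M PiM J (\<lambda>_. borel)"
    by measurable
  have X2 [measurable]: "(\<lambda>\<omega>. \<lambda>j\<in>J. \<xi> j \<omega>) \<in> P \<rightarrow>\<^sub>M PiM J (\<lambda>_. borel)"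
    by measurable
  have Q2: "emeasure Q2 B
      = (\<integral>\<^sup>+\<omega>. indicator B (\<lambda>j\<in>J. \<xi> j \<omega>) * (\<Prod>j\<in>J. ennreal (tilt (x j) (\<xi> j \<omega>))) \<partial>P)"
    if [measurable]: "B \<in> sets (PiM J (\<lambda>_. borel))" for B
  proof -
    have "emeasure Q2 B = (\<integral>\<^sup>+\<omega>. indicator B (\<lambda>j\<in>J. \<xi> j \<omega>) \<partial>D)"
      unfolding Q2_def by (rule emeasure_distr_eq_nn_integral) (use X2 that in \<open>auto simp: D_def\<close>)
    also have "\<dots> = (\<integral>\<^sup>+\<omega>. (\<Prod>j\<in>J. ennreal (tilt (x j) (\<xi> j \<omega>))) * indicator B (\<lambda>j\<in>J. \<xi> j \<omega>) \<partial>P)"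
      unfolding D_def by (rule nn_integral_density) measurable
    finally show ?thesis
      by (simp add: mult.commute)
  qed
  have Q: "Q1 = Q2"
  proof (rule measure_eqI_PiM_finite[OF J])
    show "sets Q1 = PiM J (\<lambda>_. borel)" "sets Q2 = PiM J (\<lambda>_. borel)"
      by (auto simp: Q1_def Q2_def)
    fix B :: "int \<Rightarrow> complex set"
    assume B: "\<And>i. i \<in> J \<Longrightarrow> B i \<in> sets borel"
    \<comment> \<open>Outside \<open>J\<close> the sets \<open>B j\<close> are unconstrained; the
      constant 1 makes \<open>h j\<close> measurable for every \<open>j\<close>.\<close>
    define h :: "int \<Rightarrow> complex \<Rightarrow> ennreal" where "h j = (if j \<in> J then indicator (B j) else (\<lambda>_. 1))" for j
    have h: "h j \<in> borel_measurable borel" for j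
      using B by (auto simp: h_def)
    have BM: "Pi\<^sub>E J B \<in> sets (PiM J (\<lambda>_. borel))"
      using B J by (intro sets_PiM_I_finite) auto
    have ind: "indicator (Pi\<^sub>E J B) (\<lambda>j\<in>J. f j) = (\<Prod>j\<in>J. h j (f j))" for f
      using J by (auto simp: h_def indicator_def prod_zero_iff PiE_iff)
    have "emeasure Q1 (Pi\<^sub>E J B) = (\<integral>\<^sup>+\<omega>. indicator (Pi\<^sub>E J B) (\<lambda>j\<in>J. x j + \<xi> j \<omega>) \<partial>P)"
      unfolding Q1_def by (rule emeasure_distr_eq_nn_integral[OF X1 BM])
    then show "emeasure Q1 (Pi\<^sub>E J B) = emeasure Q2 (Pi\<^sub>E J B)"
      unfolding Q2[OF BM] ind using gaussian_noise_shift[OF \<xi> J h] by simp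
  next
    show "range (\<lambda>_::nat. Pi\<^sub>E J (\<lambda>_. UNIV)) \<subseteq> prod_algebra J (\<lambda>_. borel :: complex measure)"
      using J by (auto intro: prod_algebraI_finite)
    show "(\<Union>i::nat. Pi\<^sub>E J (\<lambda>_. UNIV)) = space (PiM J (\<lambda>_. borel :: complex measure))"
      by (simp add: space_PiM)
    interpret Q1: prob_space Q1
      unfolding Q1_def by (rule prob_space_distr) measurable
    show "emeasure Q1 (Pi\<^sub>E J (\<lambda>_. UNIV)) \<noteq> \<infinity>" for i :: nat
      using Q1.emeasure_finite by simp
  qed
  \<comment> \<open>Extension by 0 is a measurable section of the restriction to \<open>J\<close>;
    pulling \<open>A\<close> back along it gives the corresponding measurable set \<open>A'\<close>
    in the finite product.\<close>
  define e :: "(int \<Rightarrow> complex) \<Rightarrow> int \<Rightarrow> complex" where "e f j = (if j \<in> J then f j else 0)" for f j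
  have e [measurable]: "e \<in> PiM J (\<lambda>_. borel) \<rightarrow>\<^sub>M borel"
  proof (rule measurable_coordinatewise_then_product)
    show "(\<lambda>f. e f i) \<in> borel_measurable (PiM J (\<lambda>_. borel))" for i
      unfolding e_def by (cases "i \<in> J") auto
  qed
  define A' where "A' = e -` A \<inter> space (PiM J (\<lambda>_. borel))"
  have A' [measurable]: "A' \<in> sets (PiM J (\<lambda>_. borel))"
    unfolding A'_def using A by measurable
  have A'_iff: "(\<lambda>j\<in>J. f j) \<in> A' \<longleftrightarrow> f \<in> A" for f
  proof -
    have "e (\<lambda>j\<in>J. f j) \<in> A \<longleftrightarrow> f \<in> A"
      by (rule dep) (simp add: e_def)
    then show ?thesis
      by (simp add: A'_def space_PiM)
  qed
  have "emeasure P {\<omega> \<in> space P. (\<lambda>n. x n + \<xi> n \<omega>) \<in> A} = emeasure Q1 A'"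
    unfolding Q1_def using A' by (subst emeasure_distr) (auto simp: A'_iff intro!: arg_cong[of _ _ "emeasure P"])
  also have "\<dots> = (\<integral>\<^sup>+\<omega>. indicator A' (\<lambda>j\<in>J. \<xi> j \<omega>) * (\<Prod>j\<in>J. ennreal (tilt (x j) (\<xi> j \<omega>))) \<partial>P)"
    unfolding Q by (rule Q2[OF A'])
  also have "\<dots> = (\<integral>\<^sup>+\<omega>. indicator A (\<lambda>n. \<xi> n \<omega>) * (\<Prod>j\<in>J. ennreal (tilt (x j) (\<xi> j \<omega>))) \<partial>P)"
    by (simp add: indicator_def A'_iff)
  finally show ?thesis .
qed

text \<open>
  The pointwise bound \<open>Z \<le> t + Z\<^sup>2/t\<close> for the density \<open>Z\<close> replaces the Cauchy--Schwarz inequality; its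
  constant does not depend on \<open>J\<close>.
\<close>

lemma gaussian_noise_shift_cylinder_le:
  assumes \<xi>: "gaussian_noise P \<xi>" and J: "finite J" and A: "A \<in> sets borel"
    and dep: "\<And>f g :: int \<Rightarrow> complex. (\<And>j. j \<in> J \<Longrightarrow> f j = g j) \<Longrightarrow> f \<in> A \<longleftrightarrow> g \<in> A"
    and x: "(\<Sum>j\<in>J. (cmod (x j))\<^sup>2) \<le> B" and t: "t > 0"
  shows "emeasure P {\<omega> \<in> space P. (\<lambda>n. x n + \<xi> n \<omega>) \<in> A}
    \<le> ennreal t * emeasure P {\<omega> \<in> space P. (\<lambda>n. \<xi> n \<omega>) \<in> A} + ennreal (exp B / t)"
proof -
  interpret prob_space P
    using \<xi> by (simp add: gaussian_noise_def)
  note [measurable] = measurable_noise[OF \<xi>] A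
  have g: "std_complex_gaussian P (\<xi> j)" for j
    using \<xi> by (simp add: gaussian_noise_def)
  define Z where "Z \<omega> = (\<Prod>j\<in>J. tilt (x j) (\<xi> j \<omega>))" for \<omega>
  have Z0: "Z \<omega> \<ge> 0" for \<omega>
    by (simp add: Z_def prod_nonneg tilt_nonneg)
  have [measurable]: "Z \<in> borel_measurable P"
    unfolding Z_def by measurable
  \<comment> \<open>By independence the second moment is the product of the factors
    \<open>exp ((cmod (x j))\<^sup>2)\<close>, so the bound on the sum of squares controls
    it.\<close>
  have Z2: "(\<integral>\<^sup>+\<omega>. ennreal ((Z \<omega>)\<^sup>2) \<partial>P) \<le> ennreal (exp B)"
  proof -
    have ind: "indep_vars (\<lambda>_. borel) (\<lambda>j \<omega>. ennreal ((tilt (x j) (\<xi> j \<omega>))\<^sup>2)) J"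
    proof -
      have "indep_vars (\<lambda>_. borel) \<xi> J"
        using \<xi> indep_vars_subset by (force simp: gaussian_noise_def)
      then show ?thesis
        by (rule indep_vars_compose2) measurable
    qed
    have "(\<integral>\<^sup>+\<omega>. ennreal ((Z \<omega>)\<^sup>2) \<partial>P) = (\<integral>\<^sup>+\<omega>. (\<Prod>j\<in>J. ennreal ((tilt (x j) (\<xi> j \<omega>))\<^sup>2)) \<partial>P)"
      by (simp add: Z_def prod_power_distrib prod_ennreal)
    also have "\<dots> = (\<Prod>j\<in>J. \<integral>\<^sup>+\<omega>. ennreal ((tilt (x j) (\<xi> j \<omega>))\<^sup>2) \<partial>P)"
      by (rule indep_vars_nn_integral[OF J ind]) simp
    also have "\<dots> = ennreal (exp (\<Sum>j\<in>J. (cmod (x j))\<^sup>2))"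
      using J by (simp add: nn_integral_tilt_square[OF g] prod_ennreal exp_sum)
    also have "\<dots> \<le> ennreal (exp B)"
      using x by (intro ennreal_leI) simp
    finally show ?thesis .
  qed
  have "emeasure P {\<omega> \<in> space P. (\<lambda>n. x n + \<xi> n \<omega>) \<in> A} = (\<integral>\<^sup>+\<omega>. indicator A (\<lambda>n. \<xi> n \<omega>) * ennreal (Z \<omega>) \<partial>P)"
    using gaussian_noise_shift_cylinder[OF \<xi> J A dep, of x] by (simp add: Z_def prod_ennreal tilt_nonneg)
  \<comment> \<open>The indicator is kept only on the first term, where the smallness of
    \<open>A\<close> counts; the second is made small by a large \<open>t\<close>.\<close>
  also have "\<dots> \<le> (\<integral>\<^sup>+\<omega>. ennreal t * indicator A (\<lambda>n. \<xi> n \<omega>) + ennreal (1 / t) * ennreal ((Z \<omega>)\<^sup>2) \<partial>P)"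
  proof (rule nn_integral_mono)
    fix \<omega>
    have "Z \<omega> \<le> t + (1 / t) * (Z \<omega>)\<^sup>2"
    proof (cases "Z \<omega> \<le> t")
      case False
      then have "t * Z \<omega> \<le> Z \<omega> * Z \<omega>"
        using Z0[of \<omega>] by (intro mult_right_mono) auto
      then have "Z \<omega> \<le> (1 / t) * (Z \<omega>)\<^sup>2"
        using t by (simp add: field_simps power2_eq_square)
      then show ?thesis
        using t by simp
    qed (use t in \<open>simp add: add_increasing2\<close>)
    then have "ennreal (Z \<omega>) \<le> ennreal t + ennreal (1 / t) * ennreal ((Z \<omega>)\<^sup>2)"
      using t by (simp add: ennreal_mult[symmetric] ennreal_plus[symmetric] ennreal_leI del: ennreal_plus)
    then show "indicator A (\<lambda>n. \<xi> n \<omega>) * ennreal (Z \<omega>)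
        \<le> ennreal t * indicator A (\<lambda>n. \<xi> n \<omega>) + ennreal (1 / t) * ennreal ((Z \<omega>)\<^sup>2)"
      by (simp add: indicator_def)
  qed
  also have "\<dots> = ennreal t * (\<integral>\<^sup>+\<omega>. indicator A (\<lambda>n. \<xi> n \<omega>) \<partial>P) + ennreal (1 / t) * (\<integral>\<^sup>+\<omega>. ennreal ((Z \<omega>)\<^sup>2) \<partial>P)"
    by (subst nn_integral_add) (auto simp: nn_integral_cmult)
  also have "(\<integral>\<^sup>+\<omega>. indicator A (\<lambda>n. \<xi> n \<omega>) \<partial>P) = emeasure P {\<omega> \<in> space P. (\<lambda>n. \<xi> n \<omega>) \<in> A}"
  proof -
    have "(\<integral>\<^sup>+\<omega>. indicator A (\<lambda>n. \<xi> n \<omega>) \<partial>P) = emeasure (distr P borel (\<lambda>\<omega> n. \<xi> n \<omega>)) A"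
      by (rule emeasure_distr_eq_nn_integral[symmetric]) measurable
    then show ?thesis
      by (simp add: emeasure_distr vimage_def Int_def conj_commute)
  qed
  also have "ennreal (1 / t) * (\<integral>\<^sup>+\<omega>. ennreal ((Z \<omega>)\<^sup>2) \<partial>P) \<le> ennreal (1 / t) * ennreal (exp B)"
    by (intro mult_left_mono Z2) simp
  also have "\<dots> = ennreal (exp B / t)"
    using t by (simp add: ennreal_mult[symmetric])
  finally show ?thesis
    by (simp add: add_left_mono)
qed

section \<open>From cylinders to open and Borel sets\<close>

text \<open>An open set of the countable product is an increasing union of finite unions of basic
  boxes. Each finite union depends on finitely many coordinates, and the cylinder bound is uniform
  in them, so it survives the limit.\<close>

lemma gaussian_noise_shift_open_le:
  assumes \<xi>: "gaussian_noise P \<xi>" and U: "open (U :: (int \<Rightarrow> complex) set)"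
    and x: "\<And>J. finite J \<Longrightarrow> (\<Sum>j\<in>J. (cmod (x j))\<^sup>2) \<le> B" and t: "t > 0"
  shows "emeasure P {\<omega> \<in> space P. (\<lambda>n. x n + \<xi> n \<omega>) \<in> U}
    \<le> ennreal t * emeasure P {\<omega> \<in> space P. (\<lambda>n. \<xi> n \<omega>) \<in> U} + ennreal (exp B / t)"
proof -
  interpret prob_space P
    using \<xi> by (simp add: gaussian_noise_def)
  note [measurable] = measurable_noise[OF \<xi>]
  obtain K :: "(int \<Rightarrow> complex) set set" where K: "topological_basis K" "countable K"
    "\<And>k. k \<in> K \<Longrightarrow> \<exists>X. k = Pi\<^sub>E UNIV X \<and> (\<forall>i. open (X i)) \<and> finite {i. X i \<noteq> UNIV}"
    using product_topology_countable_basis by metis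
  obtain K' where K': "K' \<subseteq> K" "\<Union>K' = U"
    using K(1) U unfolding topological_basis_def by metis
  \<comment> \<open>Inserting the empty set keeps the enumerated family nonempty even when
    \<open>U\<close> is empty.\<close>
  define b where "b = from_nat_into (insert {} K')"
  have "countable (insert {} K')"
    using K(2) K'(1) countable_subset by blast
  then have range_b: "range b = insert {} K'"
    unfolding b_def by (intro range_from_nat_into) auto
  have b: "\<exists>J. finite J \<and> (\<forall>f g. (\<forall>j\<in>J. f j = g j) \<longrightarrow> (f \<in> b i \<longleftrightarrow> g \<in> b i))" for i
  proof -
    consider "b i = {}" | "b i \<in> K"
      using range_b K'(1) by auto
    then show ?thesis
    proof cases
      case 2
      then obtain X where "b i = Pi\<^sub>E UNIV X" "finite {i. X i \<noteq> UNIV}"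
        using K(3) by blast
      then show ?thesis
        by (intro exI[of _ "{i. X i \<noteq> UNIV}"]) (auto simp: PiE_iff; metis UNIV_I)
    qed auto
  qed
  then obtain J where J: "\<And>i. finite (J i)" "\<And>i f g. (\<forall>j\<in>J i. f j = g j) \<Longrightarrow> f \<in> b i \<longleftrightarrow> g \<in> b i"
    by metis
  have b_open: "open (b i)" for i
    using range_b K'(1) topological_basis_open[OF K(1)] by (metis insertE open_empty rangeI subsetD)
  define V where "V m = (\<Union>i<m. b i)" for m :: nat
  have V_open: "open (V m)" for m
    unfolding V_def by (intro open_UN ballI b_open)
  then have [measurable]: "V m \<in> sets borel" for m
    by simp
  have U_eq: "U = (\<Union>m. V m)"
  proof -
    have "(\<Union>m. V m) = \<Union>(range b)"
      unfolding V_def by (auto intro: lessI)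
    then show ?thesis
      using K'(2) by (simp add: range_b)
  qed
  have le: "emeasure P {\<omega> \<in> space P. (\<lambda>n. x n + \<xi> n \<omega>) \<in> V m}
      \<le> ennreal t * emeasure P {\<omega> \<in> space P. (\<lambda>n. \<xi> n \<omega>) \<in> U} + ennreal (exp B / t)" for m
  proof -
    have "emeasure P {\<omega> \<in> space P. (\<lambda>n. x n + \<xi> n \<omega>) \<in> V m}
        \<le> ennreal t * emeasure P {\<omega> \<in> space P. (\<lambda>n. \<xi> n \<omega>) \<in> V m} + ennreal (exp B / t)"
    proof (rule gaussian_noise_shift_cylinder_le[OF \<xi> _ _ _ x t])
      show "finite (\<Union>i<m. J i)" "finite (\<Union>i<m. J i)"
        using J(1) by auto
      show "f \<in> V m \<longleftrightarrow> g \<in> V m" if eq: "\<And>j. j \<in> (\<Union>i<m. J i) \<Longrightarrow> f j = g j" for f g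
      proof -
        have "f \<in> b i \<longleftrightarrow> g \<in> b i" if "i < m" for i
          by (rule J(2)) (use that eq in auto)
        then show ?thesis
          by (auto simp: V_def)
      qed
    qed measurable
    also have "\<dots> \<le> ennreal t * emeasure P {\<omega> \<in> space P. (\<lambda>n. \<xi> n \<omega>) \<in> U} + ennreal (exp B / t)"
      using U by (intro add_right_mono mult_left_mono emeasure_mono) (auto simp: U_eq)
    finally show ?thesis .
  qed
  have "emeasure P {\<omega> \<in> space P. (\<lambda>n. x n + \<xi> n \<omega>) \<in> U}
      = emeasure P (\<Union>m. {\<omega> \<in> space P. (\<lambda>n. x n + \<xi> n \<omega>) \<in> V m})"
    by (auto simp: U_eq intro!: arg_cong[of _ _ "emeasure P"])
  also have "\<dots> = (SUP m. emeasure P {\<omega> \<in> space P. (\<lambda>n. x n + \<xi> n \<omega>) \<in> V m})"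
  proof (rule SUP_emeasure_incseq[symmetric])
    have "{\<omega> \<in> space P. (\<lambda>n. x n + \<xi> n \<omega>) \<in> V m} \<in> sets P" for m
      by measurable
    then show "range (\<lambda>m. {\<omega> \<in> space P. (\<lambda>n. x n + \<xi> n \<omega>) \<in> V m}) \<subseteq> sets P"
      by auto
  qed (auto simp: incseq_def V_def)
  also have "\<dots> \<le> ennreal t * emeasure P {\<omega> \<in> space P. (\<lambda>n. \<xi> n \<omega>) \<in> U} + ennreal (exp B / t)"
    by (intro SUP_least le)
  finally show ?thesis .
qed

text \<open>
  By outer regularity, the bound for open sets passes to all Borel sets; this is one half of the
  Cameron--Martin theorem.
\<close>

lemma gaussian_noise_shift_null:
  assumes \<xi>: "gaussian_noise P \<xi>" and S: "S \<in> sets (borel :: (int \<Rightarrow> complex) measure)"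
    and x: "\<And>J. finite J \<Longrightarrow> (\<Sum>j\<in>J. (cmod (x j))\<^sup>2) \<le> B"
    and null: "AE \<omega> in P. (\<lambda>n. \<xi> n \<omega>) \<notin> S"
  shows "AE \<omega> in P. (\<lambda>n. x n + \<xi> n \<omega>) \<notin> S"
proof -
  interpret prob_space P
    using \<xi> by (simp add: gaussian_noise_def)
  note [measurable] = measurable_noise[OF \<xi>] S
  define \<rho> where "\<rho> = distr P borel (\<lambda>\<omega> n. \<xi> n \<omega>)"
  interpret \<rho>: prob_space \<rho>
    unfolding \<rho>_def by (rule prob_space_distr) measurable
  have em: "emeasure \<rho> A = emeasure P {\<omega> \<in> space P. (\<lambda>n. \<xi> n \<omega>) \<in> A}" if "A \<in> sets borel" for A
    unfolding \<rho>_def using that by (subst emeasure_distr) (auto intro!: arg_cong[of _ _ "emeasure P"])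
  have "emeasure \<rho> S = 0"
    using null by (subst em[OF S]) (auto simp: AE_iff_measurable[OF _ refl])
  then have inf: "(INF U \<in> {U. S \<subseteq> U \<and> open U}. emeasure \<rho> U) = 0"
    using outer_regular[of \<rho> S] S \<rho>.emeasure_finite by (simp add: \<rho>_def)
  define s where "s = emeasure P {\<omega> \<in> space P. (\<lambda>n. x n + \<xi> n \<omega>) \<in> S}"
  have s_le: "s \<le> ennreal (2 * exp B / t)" if t: "t > 0" for t
  proof -
    \<comment> \<open>The threshold makes \<open>t * emeasure \<rho> U\<close> at most
      \<open>exp B / t\<close>, equal to the other term of the bound; letting \<open>t\<close> grow
      then gives probability 0.\<close>
    have "(INF U \<in> {U. S \<subseteq> U \<and> open U}. emeasure \<rho> U) < ennreal (exp B / t / t)"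
      using t by (simp add: inf)
    then obtain U where U: "S \<subseteq> U" "open U" "emeasure \<rho> U < ennreal (exp B / t / t)"
      by (auto simp: INF_less_iff)
    have [measurable]: "U \<in> sets borel"
      using U(2) by simp
    have "s \<le> emeasure P {\<omega> \<in> space P. (\<lambda>n. x n + \<xi> n \<omega>) \<in> U}"
      unfolding s_def by (rule emeasure_mono) (use U(1) in auto, measurable)
    also have "\<dots> \<le> ennreal t * emeasure \<rho> U + ennreal (exp B / t)"
      using gaussian_noise_shift_open_le[OF \<xi> U(2) x t] U(2) by (simp add: em)
    also have "\<dots> \<le> ennreal t * ennreal (exp B / t / t) + ennreal (exp B / t)"
      using U(3) by (intro add_right_mono mult_left_mono) auto
    also have "\<dots> = ennreal (2 * exp B / t)"
      using t by (simp add: ennreal_mult[symmetric] ennreal_plus[symmetric] del: ennreal_plus)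
    finally show ?thesis .
  qed
  have "(\<lambda>n. ennreal (2 * exp B / real (Suc n))) \<longlonglongrightarrow> ennreal 0"
    by (intro tendsto_ennrealI) real_asymp
  then have "s \<le> ennreal 0"
    by (rule LIMSEQ_le_const) (use s_le in auto)
  then have "s = 0"
    by simp
  then show ?thesis
    unfolding s_def by (subst AE_iff_measurable[OF _ refl]) auto
qed

section \<open>Impossibility of detection\<close>

lemma positive_set_not_detectable:
  assumes \<xi>: "gaussian_noise P \<xi>" and E: "E \<in> sets borel" "emeasure circle_lebesgue E > 0"
  shows "\<not> admits_detection P \<xi> (fourier_transforms E - {\<lambda>_. 0})"
proof
  assume "admits_detection P \<xi> (fourier_transforms E - {\<lambda>_. 0})"
  then obtain T :: "(int \<Rightarrow> complex) \<Rightarrow> nat" where T: "T \<in> borel \<rightarrow>\<^sub>M count_space {0, 1}"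
    and T0: "AE \<omega> in P. T (\<lambda>n. \<xi> n \<omega>) = 0"
    and T1: "\<And>x. x \<in> fourier_transforms E - {\<lambda>_. 0} \<Longrightarrow> AE \<omega> in P. T (\<lambda>n. x n + \<xi> n \<omega>) = 1"
    unfolding admits_detection_def by blast
  interpret prob_space P
    using \<xi> by (simp add: gaussian_noise_def)
  define M where "M = density circle_lebesgue (indicator E)"
  have sets_M: "sets M = sets borel"
    by (simp add: M_def)
  have em_M: "emeasure M A = emeasure circle_lebesgue (E \<inter> A)" if "A \<in> sets borel" for A
    using that E(1) by (simp add: M_def emeasure_density nn_integral_set_ennreal[symmetric]
        indicator_inter_arith[symmetric])
  interpret M: finite_measure M
  proof
    show "emeasure M (space M) \<noteq> \<infinity>"
      using em_M[of UNIV] by (simp add: M_def)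
  qed
  define \<mu> :: "circle set \<Rightarrow> complex" where "\<mu> A = of_real (measure M A)" for A
  have "complex_measure borel \<mu>"
    unfolding complex_measure_def \<mu>_def using M.finite_measure_UNION
    by (auto intro!: sums_of_real simp: sets_M)
  moreover have "carried_by borel \<mu> E"
  proof -
    have "\<mu> A = 0" if "A \<subseteq> UNIV - E" "A \<in> sets borel" for A
    proof -
      have "E \<inter> A = {}"
        using that by auto
      then show ?thesis
        using em_M[OF that(2)] by (simp add: \<mu>_def measure_def)
    qed
    then have zero: "(\<Sum>n. ennreal (cmod (\<mu> (A n)))) = 0"
      if "range A \<subseteq> sets borel" "(\<Union>n. A n) = UNIV - E" for A :: "nat \<Rightarrow> circle set"
    proof -
      have "A n \<subseteq> UNIV - E" "A n \<in> sets borel" for n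
        using that by auto
      then show ?thesis
        using \<open>\<And>A. A \<subseteq> UNIV - E \<Longrightarrow> A \<in> sets borel \<Longrightarrow> \<mu> A = 0\<close> by simp
    qed
    have "total_variation borel \<mu> (UNIV - E) \<le> 0"
      unfolding total_variation_def by (rule SUP_least, subst zero) auto
    then show ?thesis
      by (simp add: carried_by_def)
  qed
  ultimately have xE: "fourier \<mu> \<in> fourier_transforms E"
    unfolding fourier_transforms_def by blast
  have fourier: "fourier \<mu> n = (\<integral>x. indicator E x * cnj (circle_char n x) \<partial>circle_lebesgue)" for n
  proof -
    \<comment> \<open>The reference measure \<open>borel\<close> is replaced by \<open>M\<close>,
      which has the same measurable sets, so that \<mu> becomes the measure of the reference space
      itself.\<close>
    have "fourier \<mu> n = complex_integral M \<mu> (circle_char (- n))"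
      unfolding fourier_def complex_integral_def signed_integral_def
      by (simp add: upper_variation_cong_sets[OF sets_M])
    also have "\<dots> = integral\<^sup>L M (circle_char (- n))"
      unfolding \<mu>_def by (rule complex_integral_measure) (rule M.finite_measure_axioms)
    also have "\<dots> = (\<integral>x. indicator E x *\<^sub>R circle_char (- n) x \<partial>circle_lebesgue)"
      unfolding M_def ennreal_indicator[symmetric]
      by (rule integral_density) (use E in auto)
    also have "\<dots> = (\<integral>x. indicator E x * cnj (circle_char n x) \<partial>circle_lebesgue)"
      by (intro Bochner_Integration.integral_cong) (auto simp: cnj_circle_char indicator_def)
    finally show ?thesis .
  qed
  \<comment> \<open>The coefficient at 0 is the total mass, whose positivity shows that the
    transform is not the excluded zero sequence.\<close>
  have "fourier \<mu> 0 = of_real (measure circle_lebesgue E)"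
  proof -
    have "fourier \<mu> 0 = (\<integral>x. of_real (indicator E x) \<partial>circle_lebesgue)"
      unfolding fourier by (intro Bochner_Integration.integral_cong) (auto simp: indicator_def)
    then show ?thesis
      using E(1) by simp
  qed
  moreover have "measure circle_lebesgue E \<noteq> 0"
    using E(2) by (simp add: circle_lebesgue.emeasure_eq_measure)
  ultimately have "fourier \<mu> \<noteq> (\<lambda>_. 0)"
    by (auto simp: fun_eq_iff intro!: exI[of _ 0])
  then have detected: "AE \<omega> in P. T (\<lambda>n. fourier \<mu> n + \<xi> n \<omega>) = 1"
    using T1 xE by blast
  \<comment> \<open>Bessel's inequality for the indicator of \<open>E\<close>. Its projection
    \<open>g\<close> onto the characters in \<open>J\<close> has squared norm \<open>S\<close> and
    inner product \<open>S\<close> with the indicator. Integrating the pointwise bound by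
    \<open>1 + (cmod (g x))\<^sup>2\<close> gives \<open>2 * S \<le> 1 + S\<close>.\<close>
  have bessel: "(\<Sum>j\<in>J. (cmod (fourier \<mu> j))\<^sup>2) \<le> 1" if J: "finite J" for J
  proof -
    define S where "S = (\<Sum>j\<in>J. (cmod (fourier \<mu> j))\<^sup>2)"
    define g where "g x = (\<Sum>j\<in>J. fourier \<mu> j * circle_char j x)" for x
    have [measurable]: "g \<in> borel_measurable borel" "E \<in> sets borel"
      using E(1) unfolding g_def by auto
    have orth: "integrable circle_lebesgue (\<lambda>x. circle_char i x * cnj (circle_char j x))"
      "(\<integral>x. circle_char i x * cnj (circle_char j x) \<partial>circle_lebesgue) = (if i = j then of_real 1 else 0)" for i j
      using circle_char_orthonormal by simp_all
    have g2: "integrable circle_lebesgue (\<lambda>x. (cmod (g x))\<^sup>2)" "(\<integral>x. (cmod (g x))\<^sup>2 \<partial>circle_lebesgue) = S"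
      using integrable_norm_sum_orthogonal[OF orth J] integral_norm_sum_orthogonal[OF orth J]
      by (simp_all add: g_def S_def)
    have int: "integrable circle_lebesgue (\<lambda>x. indicator E x * cnj (circle_char j x))" for j
      by (rule circle_lebesgue.integrable_const_bound[of _ 1]) (auto simp: indicator_def cnj_circle_char)
    have Eg: "indicator E x * cnj (g x) = (\<Sum>j\<in>J. cnj (fourier \<mu> j) * (indicator E x * cnj (circle_char j x)))" for x
      by (simp add: g_def sum_distrib_left mult_ac)
    have int_Eg: "integrable circle_lebesgue (\<lambda>x. indicator E x * cnj (g x))"
      unfolding Eg using int by auto
    have "(\<integral>x. indicator E x * cnj (g x) \<partial>circle_lebesgue) = (\<Sum>j\<in>J. cnj (fourier \<mu> j) * fourier \<mu> j)"
      unfolding Eg using int by (simp add: Bochner_Integration.integral_sum fourier[symmetric])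
    also have "\<dots> = of_real S"
      unfolding S_def of_real_sum complex_norm_square by (simp add: mult.commute)
    finally have "Re (\<integral>x. indicator E x * cnj (g x) \<partial>circle_lebesgue) = S"
      by simp
    then have "2 * S = (\<integral>x. 2 * Re (indicator E x * cnj (g x)) \<partial>circle_lebesgue)"
      using int_Eg by (simp del: times_complex.sel)
    also have "\<dots> \<le> (\<integral>x. 1 + (cmod (g x))\<^sup>2 \<partial>circle_lebesgue)"
    proof (rule integral_mono)
      fix x
      have "2 * Re (indicator E x * cnj (g x)) \<le> 2 * cmod (g x)"
        using complex_Re_le_cmod[of "cnj (g x)"] by (auto simp: indicator_def)
      also have "\<dots> \<le> 1 + (cmod (g x))\<^sup>2"
        using sum_squares_bound[of 1 "cmod (g x)"] by simp
      finally show "2 * Re (indicator E x * cnj (g x)) \<le> 1 + (cmod (g x))\<^sup>2" .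
    qed (use int_Eg g2 in \<open>auto simp del: times_complex.sel\<close>)
    also have "\<dots> = 1 + S"
      using g2 circle_lebesgue.prob_space by simp
    finally show ?thesis
      by (simp add: S_def)
  qed
  have "AE \<omega> in P. (\<lambda>n. fourier \<mu> n + \<xi> n \<omega>) \<notin> T -` {1}"
  proof (rule gaussian_noise_shift_null[OF \<xi> _ bessel])
    show "T -` {1} \<in> sets borel"
      using measurable_sets[OF T, of "{1}"] by simp
    show "AE \<omega> in P. (\<lambda>n. \<xi> n \<omega>) \<notin> T -` {1}"
      using T0 by eventually_elim simp
  qed
  with detected have "AE \<omega> in P. False"
    by eventually_elim simp
  then show False
    by simp
qed

theorem theorem4p1:
  fixes P :: "'w measure" and \<xi> :: "int \<Rightarrow> 'w \<Rightarrow> complex" and E :: "circle set"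
  assumes "gaussian_noise P \<xi>"
    and "E \<in> sets borel"
  shows "(emeasure circle_lebesgue E = 0 \<longrightarrow> admits_recovery P \<xi> (fourier_transforms E)) \<and>
    (emeasure circle_lebesgue E > 0 \<longrightarrow>
      \<not> admits_detection P \<xi> (fourier_transforms E - {\<lambda>_. 0}))"
  using null_set_admits_recovery[OF assms] positive_set_not_detectable[OF assms] by blast

end
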